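(* Let $X$ and $Y$ be real Banach spaces. There exist linear isometric embeddings $$\mathcal F^{ph}(X)\longrightarrow\mathcal F(X)^{**},\qquad X\longrightarrow\mathcal F(X)^{**},\qquad X\widehat\otimes_\pi Y\longrightarrow\bigl(\mathcal F(X)\widehat\otimes_\pi\mathcal F(Y)\bigr)^{**}.$$
   Context: For a real Banach space $X$, $\operatorname{Lip}_0(X)$ is the Banach space of Lipschitz functions $f\colon X\to\mathbb R$ with $f(0)=0$, normed by the least Lipschitz constant; $\delta_x\in\operatorname{Lip}_0(X)^*$ is evaluation at $x$, and $\mathcal F(X)=\overline{\operatorname{span}}\{\delta_x:x\in X\}\subseteq\operatorname{Lip}_0(X)^*$ is the Lipschitz-free space. The positively homogeneous free space is the quotient Banach space $\mathcal F^{ph}(X)=\mathcal F(X)/\overline{\operatorname{span}}\{\delta_{rx}-r\delta_x:r>0,\ x\in X\}$. $\widehat\otimes_\pi$ denotes the completed projective tensor product. *)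

theory Defs
  imports "HOL-Analysis.Analysis" "HOL-Library.Poly_Mapping"
begin

section \<open>Isometric embeddings and biduals\<close>

definition linear_isometric_embedding ::
    "('a::real_normed_vector \<Rightarrow> 'b::real_normed_vector) \<Rightarrow> bool"
  where "linear_isometric_embedding T \<longleftrightarrow> linear T \<and> (\<forall>x. norm (T x) = norm x)"

type_synonym 'a dual = "'a \<Rightarrow>\<^sub>L real"

type_synonym 'a bidual = "'a dual dual"


section \<open>Lipschitz functions vanishing at the origin\<close>

typedef (overloaded) 'a lip0 =
    "{f :: 'a::real_normed_vector \<Rightarrow> real. f 0 = 0 \<and> (\<exists>C. C-lipschitz_on UNIV f)}"
  morphisms lip0_apply Lip0
  by (rule exI[of _ "\<lambda>_. 0"]) (auto intro!: exI[of _ 0] simp: lipschitz_on_def)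

setup_lifting type_definition_lip0

lemma lipschitz_on_add_real:
  fixes f g :: "'a::metric_space \<Rightarrow> real"
  assumes "C-lipschitz_on UNIV f" "D-lipschitz_on UNIV g"
  shows "(C + D)-lipschitz_on UNIV (\<lambda>x. f x + g x)"
proof (rule lipschitz_onI)
  fix x y
  have "\<bar>f x - f y\<bar> \<le> C * dist x y" "\<bar>g x - g y\<bar> \<le> D * dist x y"
    using assms by (auto simp: lipschitz_on_def dist_real_def)
  then show "dist (f x + g x) (f y + g y) \<le> (C + D) * dist x y"
    by (simp add: dist_real_def algebra_simps)
qed (use assms in \<open>auto simp: lipschitz_on_def\<close>)

lemma lipschitz_on_cmult_real':
  fixes f :: "'a::metric_space \<Rightarrow> real"
  assumes "C-lipschitz_on UNIV f"
  shows "(\<bar>c\<bar> * C)-lipschitz_on UNIV (\<lambda>x. c * f x)"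
proof (rule lipschitz_onI)
  fix x y
  have "\<bar>c\<bar> * \<bar>f x - f y\<bar> \<le> \<bar>c\<bar> * (C * dist x y)"
    using assms by (intro mult_left_mono) (auto simp: lipschitz_on_def dist_real_def)
  then show "dist (c * f x) (c * f y) \<le> \<bar>c\<bar> * C * dist x y"
    by (simp add: dist_real_def abs_mult[symmetric] right_diff_distrib mult.assoc)
qed (use assms in \<open>auto simp: lipschitz_on_def\<close>)

instantiation lip0 :: (real_normed_vector) real_vector
begin

lift_definition zero_lip0 :: "'a lip0" is "\<lambda>_. 0"
  by (auto intro!: exI[of _ 0] simp: lipschitz_on_def)

lift_definition plus_lip0 :: "'a lip0 \<Rightarrow> 'a lip0 \<Rightarrow> 'a lip0" is "\<lambda>f g x. f x + g x"
  using lipschitz_on_add_real by fastforce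

lift_definition scaleR_lip0 :: "real \<Rightarrow> 'a lip0 \<Rightarrow> 'a lip0" is "\<lambda>c f x. c * f x"
  using lipschitz_on_cmult_real' by fastforce

lift_definition uminus_lip0 :: "'a lip0 \<Rightarrow> 'a lip0" is "\<lambda>f x. - f x"
  using lipschitz_on_cmult_real'[where c = "- 1"] by fastforce

lift_definition minus_lip0 :: "'a lip0 \<Rightarrow> 'a lip0 \<Rightarrow> 'a lip0" is "\<lambda>f g x. f x - g x"
proof -
  fix f g :: "'a \<Rightarrow> real"
  assume "f 0 = 0 \<and> (\<exists>C. C-lipschitz_on UNIV f)" "g 0 = 0 \<and> (\<exists>C. C-lipschitz_on UNIV g)"
  then show "f 0 - g 0 = 0 \<and> (\<exists>C. C-lipschitz_on UNIV (\<lambda>x. f x - g x))"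
    using lipschitz_on_add_real[OF _ lipschitz_on_cmult_real'[where c = "- 1"]] by fastforce
qed

instance
  by standard (transfer; simp add: algebra_simps)+

end

lemma lip0_apply_zero [simp]: "lip0_apply f 0 = 0"
  by transfer simp

lemma lip0_apply_add: "lip0_apply (f + g) x = lip0_apply f x + lip0_apply g x"
  by transfer simp

lemma lip0_apply_scaleR: "lip0_apply (c *\<^sub>R f) x = c * lip0_apply f x"
  by transfer simp

lemma lip0_apply_diff: "lip0_apply (f - g) x = lip0_apply f x - lip0_apply g x"
  by transfer simp

instantiation lip0 :: (real_normed_vector) real_normed_vector
begin

definition norm_lip0 :: "'a lip0 \<Rightarrow> real"
  where "norm_lip0 f = Inf {C. C-lipschitz_on UNIV (lip0_apply f)}"

definition dist_lip0 :: "'a lip0 \<Rightarrow> 'a lip0 \<Rightarrow> real" where "dist_lip0 f g = norm (f - g)"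

definition sgn_lip0 :: "'a lip0 \<Rightarrow> 'a lip0" where "sgn_lip0 f = f /\<^sub>R norm f"

definition uniformity_lip0 :: "('a lip0 \<times> 'a lip0) filter"
  where "uniformity_lip0 = (INF e\<in>{0<..}. principal {(x, y). dist x y < e})"

definition open_lip0 :: "'a lip0 set \<Rightarrow> bool"
  where "open_lip0 U = (\<forall>x\<in>U. \<forall>\<^sub>F (x', y) in uniformity. x' = x \<longrightarrow> y \<in> U)"

lemma lip0_norm_le: "C-lipschitz_on UNIV (lip0_apply f) \<Longrightarrow> norm f \<le> C"
  unfolding norm_lip0_def
  by (rule cInf_lower) (auto intro!: bdd_belowI[of _ 0] simp: lipschitz_on_def)

lemma lip0_norm_lipschitz: "(norm f)-lipschitz_on UNIV (lip0_apply f)"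
proof -
  let ?S = "{C. C-lipschitz_on UNIV (lip0_apply f)}"
  obtain C0 where "C0 \<in> ?S" using lip0_apply[of f] by auto
  then have ne: "?S \<noteq> {}" by auto
  have nn: "0 \<le> norm f"
    unfolding norm_lip0_def by (rule cInf_greatest[OF ne]) (auto simp: lipschitz_on_def)
  show ?thesis
  proof (rule lipschitz_onI)
    fix x y :: 'a
    show "dist (lip0_apply f x) (lip0_apply f y) \<le> norm f * dist x y"
    proof (cases "x = y")
      case False
      have "dist (lip0_apply f x) (lip0_apply f y) / dist x y \<le> norm f"
        unfolding norm_lip0_def
        by (rule cInf_greatest[OF ne]) (use False in \<open>auto simp: lipschitz_on_def field_simps\<close>)
      then show ?thesis using False by (simp add: field_simps)
    qed simp
  qed (rule nn)
qed

instance
proof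
  fix f g :: "'a lip0" and c :: real
  show "dist f g = norm (f - g)" by (rule dist_lip0_def)
  show "sgn f = f /\<^sub>R norm f" by (rule sgn_lip0_def)
  show "uniformity = (INF e\<in>{0<..}. principal {(x, y :: 'a lip0). dist x y < e})"
    by (rule uniformity_lip0_def)
  show "open U = (\<forall>x\<in>U. \<forall>\<^sub>F (x', y) in uniformity. x' = x \<longrightarrow> y \<in> U)" for U :: "'a lip0 set"
    by (rule open_lip0_def)
  have ge: "0 \<le> norm h" for h :: "'a lip0"
    using lip0_norm_lipschitz[of h] by (simp add: lipschitz_on_def)
  show "norm f = 0 \<longleftrightarrow> f = 0"
  proof
    assume "norm f = 0"
    then have "lip0_apply f x = 0" for x
      using lipschitz_onD[OF lip0_norm_lipschitz[of f], of x 0] by simp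
    then show "f = 0" by (intro lip0_apply_inject[THEN iffD1]) (auto simp: zero_lip0.rep_eq)
  next
    assume "f = 0"
    then have "0-lipschitz_on UNIV (lip0_apply f)"
      by (simp add: zero_lip0.rep_eq lipschitz_on_def)
    from lip0_norm_le[OF this] ge[of f] show "norm f = 0" by simp
  qed
  show "norm (f + g) \<le> norm f + norm g"
    by (rule lip0_norm_le)
       (use lipschitz_on_add_real[OF lip0_norm_lipschitz lip0_norm_lipschitz]
         in \<open>simp add: plus_lip0.rep_eq\<close>)
  have le: "norm (d *\<^sub>R h) \<le> \<bar>d\<bar> * norm h" for d :: real and h :: "'a lip0"
    by (rule lip0_norm_le)
       (use lipschitz_on_cmult_real'[OF lip0_norm_lipschitz] in \<open>simp add: scaleR_lip0.rep_eq\<close>)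
  show "norm (c *\<^sub>R f) = \<bar>c\<bar> * norm f"
  proof (cases "c = 0")
    case True
    then show ?thesis using le[of 0 f] ge[of "0 *\<^sub>R f"] by simp
  next
    case False
    have "norm f \<le> \<bar>inverse c\<bar> * norm (c *\<^sub>R f)"
      using le[of "inverse c" "c *\<^sub>R f"] False by simp
    then have "\<bar>c\<bar> * norm f \<le> norm (c *\<^sub>R f)" using False by (simp add: field_simps)
    then show ?thesis using le[of c f] by simp
  qed
qed

end

lemma lip0_apply_dist_le: "\<bar>lip0_apply f x - lip0_apply f y\<bar> \<le> norm f * norm (x - y)"
  using lip0_norm_lipschitz[of f] by (simp add: lipschitz_on_def dist_norm)

lemma lip0_apply_le: "\<bar>lip0_apply f x\<bar> \<le> norm f * norm x"
  using lip0_apply_dist_le[of f x 0] by simp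

instance lip0 :: (real_normed_vector) banach
proof
  fix F :: "nat \<Rightarrow> 'a lip0"
  assume F: "Cauchy F"
  have "Cauchy (\<lambda>n. lip0_apply (F n) x)" for x
  proof (rule CauchyI)
    fix e :: real assume e: "0 < e"
    then have "0 < e / (norm x + 1)" by (simp add: add_nonneg_pos)
    from CauchyD[OF F this] obtain M
      where M: "\<And>m n. m \<ge> M \<Longrightarrow> n \<ge> M \<Longrightarrow> norm (F m - F n) < e / (norm x + 1)" by blast
    have "norm (lip0_apply (F m) x - lip0_apply (F n) x) < e" if "m \<ge> M" "n \<ge> M" for m n
    proof -
      have "norm (lip0_apply (F m) x - lip0_apply (F n) x) \<le> norm (F m - F n) * norm x"
        using lip0_apply_le[of "F m - F n" x] by (simp add: lip0_apply_diff)
      also have "\<dots> \<le> norm (F m - F n) * (norm x + 1)" by (intro mult_left_mono) auto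
      also have "\<dots> < e" using M[OF that] by (simp add: pos_less_divide_eq add_nonneg_pos)
      finally show ?thesis .
    qed
    then show "\<exists>M. \<forall>m\<ge>M. \<forall>n\<ge>M. norm (lip0_apply (F m) x - lip0_apply (F n) x) < e" by blast
  qed
  then have "\<forall>x. \<exists>l. (\<lambda>n. lip0_apply (F n) x) \<longlonglongrightarrow> l"
    by (simp add: Cauchy_convergent_iff convergent_def)
  then obtain g where g: "\<And>x. (\<lambda>n. lip0_apply (F n) x) \<longlonglongrightarrow> g x" by metis
  have close: "\<exists>M. \<forall>n\<ge>M. e-lipschitz_on UNIV (\<lambda>x. lip0_apply (F n) x - g x)"
    if e: "0 < e" for e
  proof -
    from CauchyD[OF F e] obtain M
      where M: "\<And>m n. m \<ge> M \<Longrightarrow> n \<ge> M \<Longrightarrow> norm (F m - F n) < e" by blast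
    have "e-lipschitz_on UNIV (\<lambda>x. lip0_apply (F n) x - g x)" if n: "n \<ge> M" for n
    proof (rule lipschitz_onI)
      fix x y
      have "\<bar>(lip0_apply (F n) x - lip0_apply (F m) x) - (lip0_apply (F n) y - lip0_apply (F m) y)\<bar>
          \<le> e * norm (x - y)" if "m \<ge> M" for m
        using lip0_apply_dist_le[of "F n - F m" x y] M[OF n that]
          mult_right_mono[of "norm (F n - F m)" e "norm (x - y)"]
        by (simp add: lip0_apply_diff)
      then have "\<forall>\<^sub>F m in sequentially. \<bar>(lip0_apply (F n) x - lip0_apply (F m) x)
          - (lip0_apply (F n) y - lip0_apply (F m) y)\<bar> \<le> e * norm (x - y)"
        by (auto simp: eventually_sequentially)
      moreover have "(\<lambda>m. \<bar>(lip0_apply (F n) x - lip0_apply (F m) x)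
          - (lip0_apply (F n) y - lip0_apply (F m) y)\<bar>)
          \<longlonglongrightarrow> \<bar>(lip0_apply (F n) x - g x) - (lip0_apply (F n) y - g y)\<bar>"
        by (intro tendsto_intros g)
      ultimately have "\<bar>(lip0_apply (F n) x - g x) - (lip0_apply (F n) y - g y)\<bar>
          \<le> e * norm (x - y)"
        by (intro tendsto_upperbound[where F = sequentially]) auto
      then show "dist (lip0_apply (F n) x - g x) (lip0_apply (F n) y - g y) \<le> e * dist x y"
        by (simp add: dist_norm)
    qed (use e in simp)
    then show ?thesis by blast
  qed
  have g0: "g 0 = 0" using g[of 0] by (simp add: LIMSEQ_const_iff)
  obtain n where n: "1-lipschitz_on UNIV (\<lambda>x. lip0_apply (F n) x - g x)"
    using close[of 1] by auto
  have "(norm (F n) + \<bar>- 1\<bar> * 1)-lipschitz_on UNIV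
      (\<lambda>x. lip0_apply (F n) x + (- 1) * (lip0_apply (F n) x - g x))"
    by (intro lipschitz_on_add_real lip0_norm_lipschitz lipschitz_on_cmult_real' n)
  then have "\<exists>C. C-lipschitz_on UNIV g" by auto
  then have G: "lip0_apply (Lip0 g) = g" using g0 by (simp add: Lip0_inverse)
  have "F \<longlonglongrightarrow> Lip0 g"
  proof (rule LIMSEQ_I)
    fix r :: real assume "0 < r"
    then obtain M where M: "\<forall>n\<ge>M. (r/2)-lipschitz_on UNIV (\<lambda>x. lip0_apply (F n) x - g x)"
      using close[of "r/2"] by auto
    have "norm (F n - Lip0 g) < r" if "n \<ge> M" for n
    proof -
      have "lip0_apply (F n - Lip0 g) = (\<lambda>x. lip0_apply (F n) x - g x)"
        by (simp add: fun_eq_iff lip0_apply_diff G)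
      with M that have "norm (F n - Lip0 g) \<le> r/2" by (intro lip0_norm_le) simp
      then show ?thesis using \<open>0 < r\<close> by simp
    qed
    then show "\<exists>M. \<forall>n\<ge>M. norm (F n - Lip0 g) < r" by blast
  qed
  then show "convergent F" by (auto simp: convergent_def)
qed


section \<open>The Lipschitz-free space\<close>

lift_definition lip0_delta :: "'a::real_normed_vector \<Rightarrow> 'a lip0 dual"
  is "\<lambda>x f. lip0_apply f x"
proof -
  fix x :: 'a
  show "bounded_linear (\<lambda>f. lip0_apply f x)"
    by (rule bounded_linear_intro[of _ "norm x"])
       (auto simp: lip0_apply_add lip0_apply_scaleR lip0_apply_le)
qed

typedef (overloaded) 'a lip_free =
    "closure (span (range (lip0_delta :: 'a::real_normed_vector \<Rightarrow> 'a lip0 dual)))"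
  morphisms lip_free_embed Lip_Free
  using span_zero closure_subset by blast

setup_lifting type_definition_lip_free

lemma subspace_closure:
  fixes S :: "'v::real_normed_vector set"
  assumes "subspace S"
  shows "subspace (closure S)"
  unfolding subspace_def
proof (intro conjI ballI allI)
  show "0 \<in> closure S" using subspace_0[OF assms] closure_subset by blast
next
  fix x y assume "x \<in> closure S" "y \<in> closure S"
  then obtain u v where u: "\<forall>n. u n \<in> S" "u \<longlonglongrightarrow> x" and v: "\<forall>n. v n \<in> S" "v \<longlonglongrightarrow> y"
    unfolding closure_sequential by blast
  then have "\<forall>n. u n + v n \<in> S" using subspace_add[OF assms] by blast
  moreover have "(\<lambda>n. u n + v n) \<longlonglongrightarrow> x + y" using u v by (intro tendsto_add)
  ultimately show "x + y \<in> closure S" unfolding closure_sequential by (intro exI conjI)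
next
  fix c x assume "x \<in> closure S"
  then obtain u where u: "\<forall>n. u n \<in> S" "u \<longlonglongrightarrow> x" unfolding closure_sequential by blast
  then have "\<forall>n. c *\<^sub>R u n \<in> S" using subspace_scale[OF assms] by blast
  moreover have "(\<lambda>n. c *\<^sub>R u n) \<longlonglongrightarrow> c *\<^sub>R x" using u by (intro tendsto_intros)
  ultimately show "c *\<^sub>R x \<in> closure S" unfolding closure_sequential by (intro exI conjI)
qed

lemma subspace_lip_free:
  "subspace (closure (span (range (lip0_delta :: 'a::real_normed_vector \<Rightarrow> _))))"
  by (intro subspace_closure subspace_span)

instantiation lip_free :: (real_normed_vector) real_vector
begin

lift_definition zero_lip_free :: "'a lip_free" is 0
  by (rule subspace_0[OF subspace_lip_free])

lift_definition plus_lip_free :: "'a lip_free \<Rightarrow> 'a lip_free \<Rightarrow> 'a lip_free" is "(+)"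
  by (rule subspace_add[OF subspace_lip_free])

lift_definition minus_lip_free :: "'a lip_free \<Rightarrow> 'a lip_free \<Rightarrow> 'a lip_free" is "(-)"
  by (rule subspace_diff[OF subspace_lip_free])

lift_definition uminus_lip_free :: "'a lip_free \<Rightarrow> 'a lip_free" is uminus
  by (rule subspace_neg[OF subspace_lip_free])

lift_definition scaleR_lip_free :: "real \<Rightarrow> 'a lip_free \<Rightarrow> 'a lip_free" is scaleR
  by (rule subspace_scale[OF subspace_lip_free])

instance
  by standard (transfer; simp add: algebra_simps)+

end

instantiation lip_free :: (real_normed_vector) real_normed_vector
begin

lift_definition norm_lip_free :: "'a lip_free \<Rightarrow> real" is norm .

definition dist_lip_free :: "'a lip_free \<Rightarrow> 'a lip_free \<Rightarrow> real"
  where "dist_lip_free x y = norm (x - y)"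

definition sgn_lip_free :: "'a lip_free \<Rightarrow> 'a lip_free"
  where "sgn_lip_free x = x /\<^sub>R norm x"

definition uniformity_lip_free :: "('a lip_free \<times> 'a lip_free) filter"
  where "uniformity_lip_free = (INF e\<in>{0<..}. principal {(x, y). dist x y < e})"

definition open_lip_free :: "'a lip_free set \<Rightarrow> bool"
  where "open_lip_free U = (\<forall>x\<in>U. \<forall>\<^sub>F (x', y) in uniformity. x' = x \<longrightarrow> y \<in> U)"

instance
proof
  fix x y :: "'a lip_free" and c :: real
  show "dist x y = norm (x - y)" by (rule dist_lip_free_def)
  show "sgn x = x /\<^sub>R norm x" by (rule sgn_lip_free_def)
  show "uniformity = (INF e\<in>{0<..}. principal {(x, y :: 'a lip_free). dist x y < e})"
    by (rule uniformity_lip_free_def)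
  show "open U = (\<forall>x\<in>U. \<forall>\<^sub>F (x', y) in uniformity. x' = x \<longrightarrow> y \<in> U)" for U :: "'a lip_free set"
    by (rule open_lip_free_def)
  show "norm (x + y) \<le> norm x + norm y" by transfer (rule norm_triangle_ineq)
qed (transfer; simp add: algebra_simps)+

end

instance lip_free :: (real_normed_vector) banach
proof
  fix F :: "nat \<Rightarrow> 'a lip_free"
  assume "Cauchy F"
  then have "Cauchy (\<lambda>n. lip_free_embed (F n))"
    by (simp add: Cauchy_def dist_norm norm_lip_free.rep_eq minus_lip_free.rep_eq)
  then obtain l where l: "(\<lambda>n. lip_free_embed (F n)) \<longlonglongrightarrow> l"
    by (auto simp: Cauchy_convergent_iff convergent_def)
  have "l \<in> closure (span (range lip0_delta))"
    by (rule closed_sequentially[OF closed_closure _ l]) (rule lip_free_embed)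
  then have "lip_free_embed (Lip_Free l) = l" by (rule Lip_Free_inverse)
  with l have "F \<longlonglongrightarrow> Lip_Free l"
    by (simp add: LIMSEQ_def dist_norm norm_lip_free.rep_eq minus_lip_free.rep_eq)
  then show "convergent F" by (auto simp: convergent_def)
qed

lift_definition lip_free_delta :: "'a::real_normed_vector \<Rightarrow> 'a lip_free" is lip0_delta
  by (rule subsetD[OF closure_subset], rule span_base, rule rangeI)


section \<open>The positively homogeneous free space\<close>

definition ph_relations :: "'a::real_normed_vector lip_free set"
  where "ph_relations = closure (span
    {lip_free_delta (r *\<^sub>R x) - r *\<^sub>R lip_free_delta x | r x. 0 < r})"

lemma subspace_ph_relations: "subspace ph_relations"
  unfolding ph_relations_def by (intro subspace_closure subspace_span)

lemma closed_ph_relations: "closed ph_relations"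
  unfolding ph_relations_def by simp

lemma equivp_subspace_diff:
  fixes N :: "'v::real_vector set"
  assumes "subspace N"
  shows "equivp (\<lambda>x y. x - y \<in> N)"
proof (rule equivpI)
  show "reflp (\<lambda>x y. x - y \<in> N)" using subspace_0[OF assms] by (simp add: reflp_def)
  show "symp (\<lambda>x y. x - y \<in> N)"
  proof (rule sympI)
    fix x y assume "x - y \<in> N"
    from subspace_neg[OF assms this] show "y - x \<in> N" by simp
  qed
  show "transp (\<lambda>x y. x - y \<in> N)"
  proof (rule transpI)
    fix x y z assume "x - y \<in> N" "y - z \<in> N"
    from subspace_add[OF assms this] show "x - z \<in> N" by simp
  qed
qed

quotient_type (overloaded) 'a ph_free = "'a::real_normed_vector lip_free" /
    "\<lambda>m n. m - n \<in> ph_relations"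
  morphisms Rep_ph_free ph_free_class
  by (rule equivp_subspace_diff[OF subspace_ph_relations])

lemma ph_free_class_eq_iff: "ph_free_class m = ph_free_class n \<longleftrightarrow> m - n \<in> ph_relations"
  by (rule ph_free.abs_eq_iff)

lemma ph_free_class_surj: "\<exists>m. q = ph_free_class m"
  using Quotient3_abs_rep[OF Quotient3_ph_free, of q, symmetric] by (rule exI)

instantiation ph_free :: (real_normed_vector) real_vector
begin

lift_definition zero_ph_free :: "'a ph_free" is 0 .

lift_definition plus_ph_free :: "'a ph_free \<Rightarrow> 'a ph_free \<Rightarrow> 'a ph_free" is "(+)"
  using subspace_add[OF subspace_ph_relations] by (fastforce simp: algebra_simps)

lift_definition minus_ph_free :: "'a ph_free \<Rightarrow> 'a ph_free \<Rightarrow> 'a ph_free" is "(-)"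
  using subspace_diff[OF subspace_ph_relations] by (fastforce simp: algebra_simps)

lift_definition uminus_ph_free :: "'a ph_free \<Rightarrow> 'a ph_free" is uminus
  using subspace_neg[OF subspace_ph_relations] by fastforce

lift_definition scaleR_ph_free :: "real \<Rightarrow> 'a ph_free \<Rightarrow> 'a ph_free" is scaleR
  using subspace_scale[OF subspace_ph_relations] by (fastforce simp: scaleR_diff_right[symmetric])

instance
  by standard (transfer; simp add: algebra_simps subspace_0[OF subspace_ph_relations])+

end

instantiation ph_free :: (real_normed_vector) real_normed_vector
begin

definition norm_ph_free :: "'a ph_free \<Rightarrow> real"
  where "norm_ph_free q = Inf {norm m | m. ph_free_class m = q}"

definition dist_ph_free :: "'a ph_free \<Rightarrow> 'a ph_free \<Rightarrow> real"
  where "dist_ph_free x y = norm (x - y)"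

definition sgn_ph_free :: "'a ph_free \<Rightarrow> 'a ph_free"
  where "sgn_ph_free x = x /\<^sub>R norm x"

definition uniformity_ph_free :: "('a ph_free \<times> 'a ph_free) filter"
  where "uniformity_ph_free = (INF e\<in>{0<..}. principal {(x, y). dist x y < e})"

definition open_ph_free :: "'a ph_free set \<Rightarrow> bool"
  where "open_ph_free U = (\<forall>x\<in>U. \<forall>\<^sub>F (x', y) in uniformity. x' = x \<longrightarrow> y \<in> U)"

lemma ph_free_norm_le: "norm (ph_free_class m) \<le> norm m"
  unfolding norm_ph_free_def by (rule cInf_lower) (auto intro!: bdd_belowI[of _ 0])

lemma ph_free_norm_ge:
  assumes "\<And>m. ph_free_class m = q \<Longrightarrow> c \<le> norm m"
  shows "c \<le> norm q"
  unfolding norm_ph_free_def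
  by (rule cInf_greatest) (use assms ph_free_class_surj[of q] in auto)

lemma ph_free_norm_less:
  assumes "norm q < c"
  obtains m where "ph_free_class m = q" "norm m < c"
  using assms ph_free_norm_ge[of q c] by force

instance
proof
  fix x y :: "'a ph_free" and c :: real
  show "dist x y = norm (x - y)" by (rule dist_ph_free_def)
  show "sgn x = x /\<^sub>R norm x" by (rule sgn_ph_free_def)
  show "uniformity = (INF e\<in>{0<..}. principal {(x, y :: 'a ph_free). dist x y < e})"
    by (rule uniformity_ph_free_def)
  show "open U = (\<forall>x\<in>U. \<forall>\<^sub>F (x', y) in uniformity. x' = x \<longrightarrow> y \<in> U)" for U :: "'a ph_free set"
    by (rule open_ph_free_def)
  have ge: "0 \<le> norm q" for q :: "'a ph_free" by (rule ph_free_norm_ge) simp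
  have zero: "norm (0 :: 'a ph_free) = 0"
    using ph_free_norm_le[of 0] ge[of 0] by (simp add: zero_ph_free.abs_eq)
  show "norm x = 0 \<longleftrightarrow> x = 0"
  proof
    assume nx: "norm x = 0"
    obtain m where m: "x = ph_free_class m" using ph_free_class_surj by blast
    have "m \<in> closure ph_relations"
      unfolding closure_approachable
    proof safe
      fix e :: real assume "0 < e"
      then obtain n where n: "ph_free_class n = x" "norm n < e"
        using ph_free_norm_less[of x e] nx by auto
      then have "m - n \<in> ph_relations" using m by (metis ph_free_class_eq_iff)
      moreover have "dist (m - n) m < e" using n by (simp add: dist_norm)
      ultimately show "\<exists>k\<in>ph_relations. dist k m < e" by blast
    qed
    then have "m \<in> ph_relations" by (simp add: closed_ph_relations)
    then show "x = 0" by (simp add: m zero_ph_free.abs_eq ph_free_class_eq_iff)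
  qed (simp add: zero)
  show "norm (x + y) \<le> norm x + norm y"
  proof (rule field_le_epsilon)
    fix e :: real assume "0 < e"
    obtain m where m: "ph_free_class m = x" "norm m < norm x + e/2"
      using ph_free_norm_less[of x "norm x + e/2"] \<open>0 < e\<close> by auto
    obtain n where n: "ph_free_class n = y" "norm n < norm y + e/2"
      using ph_free_norm_less[of y "norm y + e/2"] \<open>0 < e\<close> by auto
    have "norm (x + y) \<le> norm (m + n)"
      using ph_free_norm_le[of "m + n"] m n by (simp add: plus_ph_free.abs_eq[symmetric])
    then show "norm (x + y) \<le> norm x + norm y + e"
      using norm_triangle_ineq[of m n] m n by simp
  qed
  have le: "norm (d *\<^sub>R q) \<le> \<bar>d\<bar> * norm q" if "d \<noteq> 0" for d :: real and q :: "'a ph_free"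
  proof -
    have "norm (d *\<^sub>R q) / \<bar>d\<bar> \<le> norm q"
    proof (rule ph_free_norm_ge)
      fix m assume m: "ph_free_class m = q"
      have "norm (d *\<^sub>R q) \<le> norm (d *\<^sub>R m)"
        using ph_free_norm_le[of "d *\<^sub>R m"] m by (simp add: scaleR_ph_free.abs_eq[symmetric])
      then show "norm (d *\<^sub>R q) / \<bar>d\<bar> \<le> norm m" using that by (simp add: field_simps)
    qed
    then show ?thesis using \<open>d \<noteq> 0\<close> by (simp add: field_simps)
  qed
  show "norm (c *\<^sub>R x) = \<bar>c\<bar> * norm x"
  proof (cases "c = 0")
    case False
    then have "norm x \<le> \<bar>inverse c\<bar> * norm (c *\<^sub>R x)"
      using le[of "inverse c" "c *\<^sub>R x"] by simp
    then have "\<bar>c\<bar> * norm x \<le> norm (c *\<^sub>R x)" using False by (simp add: field_simps)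
    then show ?thesis using le[OF False, of x] by simp
  qed (simp add: zero)
qed

end

instance ph_free :: (real_normed_vector) banach
proof
  fix X :: "nat \<Rightarrow> 'a ph_free"
  assume X: "Cauchy X"
  have "\<exists>M. \<forall>m\<ge>M. \<forall>n\<ge>M. norm (X m - X n) < (1/2)^k" for k :: nat
    using CauchyD[OF X, of "(1/2)^k"] by simp
  then obtain N where N: "\<And>k m n. m \<ge> N k \<Longrightarrow> n \<ge> N k \<Longrightarrow> norm (X m - X n) < (1/2)^k"
    by metis
  define r where "r = rec_nat (N 0) (\<lambda>k rk. max (Suc rk) (N (Suc k)))"
  have rN: "r k \<ge> N k" for k by (cases k) (auto simp: r_def)
  have r_Suc: "r k < r (Suc k)" for k by (simp add: r_def less_max_iff_disj)
  then have mono: "strict_mono r" by (simp add: strict_mono_Suc_iff)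
  have "norm (X (r (Suc k)) - X (r k)) < (1/2)^k" for k
    by (intro N) (use rN[of k] r_Suc[of k] in auto)
  then have "\<exists>m. ph_free_class m = X (r (Suc k)) - X (r k) \<and> norm m < (1/2)^k" for k
    using ph_free_norm_less by metis
  then obtain m where m: "\<And>k. ph_free_class (m k) = X (r (Suc k)) - X (r k)"
      "\<And>k. norm (m k) < (1/2)^k" by metis
  obtain m0 where m0: "X (r 0) = ph_free_class m0" using ph_free_class_surj by blast
  have "summable m"
    by (rule summable_comparison_test'[where g = "\<lambda>k. (1/2)^k" and N = 0])
       (use m(2) in \<open>auto intro: less_imp_le summable_geometric\<close>)
  then have lim: "(\<lambda>n. m0 + (\<Sum>k<n. m k)) \<longlonglongrightarrow> m0 + suminf m"
    by (intro tendsto_intros summable_LIMSEQ)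
  have Xr: "X (r n) = ph_free_class (m0 + (\<Sum>k<n. m k))" for n
    by (induction n)
       (simp_all add: m0 add.assoc[symmetric] plus_ph_free.abs_eq[symmetric] m)
  have "(\<lambda>n. X (r n)) \<longlonglongrightarrow> ph_free_class (m0 + suminf m)"
  proof (rule LIM_zero_cancel, rule Lim_null_comparison)
    show "\<forall>\<^sub>F n in sequentially. norm (X (r n) - ph_free_class (m0 + suminf m))
        \<le> norm ((m0 + (\<Sum>k<n. m k)) - (m0 + suminf m))"
      unfolding Xr minus_ph_free.abs_eq by (intro always_eventually allI ph_free_norm_le)
    show "(\<lambda>n. norm ((m0 + (\<Sum>k<n. m k)) - (m0 + suminf m))) \<longlonglongrightarrow> 0"
      by (intro tendsto_norm_zero LIM_zero lim)
  qed
  then have "(X \<circ> r) \<longlonglongrightarrow> ph_free_class (m0 + suminf m)" by (simp add: o_def)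
  with X mono have "X \<longlonglongrightarrow> ph_free_class (m0 + suminf m)" by (rule Cauchy_converges_subseq)
  then show "convergent X" by (auto simp: convergent_def)
qed


section \<open>The algebraic tensor product and the projective norm\<close>

instantiation poly_mapping :: (type, real_vector) real_vector
begin

lift_definition scaleR_poly_mapping :: "real \<Rightarrow> ('a \<Rightarrow>\<^sub>0 'b) \<Rightarrow> 'a \<Rightarrow>\<^sub>0 'b"
  is "\<lambda>c f k. c *\<^sub>R f k"
  by (erule rev_finite_subset) auto

instance
  by standard (rule poly_mapping_eqI;
    simp add: scaleR_poly_mapping.rep_eq lookup_add scaleR_add_left scaleR_add_right)+

end

text \<open>
  The formal linear combinations of pairs are factored by the subspace generated by the
  bilinearity relations.
\<close>

abbreviation formal_tensor :: "'a \<Rightarrow> 'b \<Rightarrow> ('a \<times> 'b) \<Rightarrow>\<^sub>0 real"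
  where "formal_tensor x y \<equiv> Poly_Mapping.single (x, y) 1"

definition bilinear_relations :: "(('a::real_vector \<times> 'b::real_vector) \<Rightarrow>\<^sub>0 real) set"
  where "bilinear_relations = span (
      {formal_tensor (x + x') y - formal_tensor x y - formal_tensor x' y | x x' y. True}
    \<union> {formal_tensor x (y + y') - formal_tensor x y - formal_tensor x y' | x y y'. True}
    \<union> {formal_tensor (c *\<^sub>R x) y - c *\<^sub>R formal_tensor x y | c x y. True}
    \<union> {formal_tensor x (c *\<^sub>R y) - c *\<^sub>R formal_tensor x y | c x y. True})"

lemma subspace_bilinear_relations: "subspace bilinear_relations"
  unfolding bilinear_relations_def by (rule subspace_span)

quotient_type (overloaded) ('a, 'b) tensor =
    "('a::real_vector \<times> 'b::real_vector) \<Rightarrow>\<^sub>0 real" / "\<lambda>s t. s - t \<in> bilinear_relations"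
  morphisms Rep_tensor tensor_class
  by (rule equivp_subspace_diff[OF subspace_bilinear_relations])

instantiation tensor :: (real_vector, real_vector) real_vector
begin

lift_definition zero_tensor :: "('a, 'b) tensor" is 0 .

lift_definition plus_tensor :: "('a, 'b) tensor \<Rightarrow> ('a, 'b) tensor \<Rightarrow> ('a, 'b) tensor" is "(+)"
  using subspace_add[OF subspace_bilinear_relations] by (fastforce simp: algebra_simps)

lift_definition minus_tensor :: "('a, 'b) tensor \<Rightarrow> ('a, 'b) tensor \<Rightarrow> ('a, 'b) tensor" is "(-)"
  using subspace_diff[OF subspace_bilinear_relations] by (fastforce simp: algebra_simps)

lift_definition uminus_tensor :: "('a, 'b) tensor \<Rightarrow> ('a, 'b) tensor" is uminus
  using subspace_neg[OF subspace_bilinear_relations] by fastforce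

lift_definition scaleR_tensor :: "real \<Rightarrow> ('a, 'b) tensor \<Rightarrow> ('a, 'b) tensor" is scaleR
  using subspace_scale[OF subspace_bilinear_relations]
  by (fastforce simp: scaleR_diff_right[symmetric])

instance
  by standard (transfer; simp add: algebra_simps subspace_0[OF subspace_bilinear_relations])+

end

lift_definition pure_tensor :: "'a::real_vector \<Rightarrow> 'b::real_vector \<Rightarrow> ('a, 'b) tensor"
  is formal_tensor .

lemma pure_tensor_scaleR_left: "pure_tensor (c *\<^sub>R x) y = c *\<^sub>R pure_tensor x y"
  by transfer (unfold bilinear_relations_def, rule span_base, blast)

lemma pure_tensor_scaleR_right: "pure_tensor x (c *\<^sub>R y) = c *\<^sub>R pure_tensor x y"
  by transfer (unfold bilinear_relations_def, rule span_base, blast)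

lemma pure_tensor_add_left: "pure_tensor (x + x') y = pure_tensor x y + pure_tensor x' y"
  by transfer (unfold bilinear_relations_def diff_diff_eq[symmetric], rule span_base, blast)

lemma pure_tensor_add_right: "pure_tensor x (y + y') = pure_tensor x y + pure_tensor x y'"
  by transfer (unfold bilinear_relations_def diff_diff_eq[symmetric], rule span_base, blast)

lemma tensor_eq_sum_list: "\<exists>ps. u = (\<Sum>(x, y)\<leftarrow>ps. pure_tensor x y)"
proof -
  obtain s where u: "u = tensor_class s" using Quotient3_abs_rep[OF Quotient3_tensor, of u, symmetric] by (rule that)
  show ?thesis
    unfolding u
  proof (induction s rule: update_induct)
    case const
    show ?case by (intro exI[of _ "[]"]) (simp add: zero_tensor.abs_eq)
  next
    case (update s k c)
    obtain x y where k: "k = (x, y)" by (cases k)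
    from update obtain ps where ps: "tensor_class s = (\<Sum>(x, y)\<leftarrow>ps. pure_tensor x y)" by blast
    have "Poly_Mapping.update k c s = c *\<^sub>R formal_tensor x y + s"
      using update(1)
      by (intro poly_mapping_eqI)
         (auto simp: lookup_update lookup_add scaleR_poly_mapping.rep_eq lookup_single k when_def
           in_keys_iff)
    then have "tensor_class (Poly_Mapping.update k c s) = pure_tensor (c *\<^sub>R x) y + tensor_class s"
      unfolding pure_tensor_scaleR_left
      by (simp add: pure_tensor.abs_eq scaleR_tensor.abs_eq plus_tensor.abs_eq)
    then have "tensor_class (Poly_Mapping.update k c s)
        = (\<Sum>(x, y)\<leftarrow>(c *\<^sub>R x, y) # ps. pure_tensor x y)"
      by (simp add: ps)
    then show ?case by blast
  qed
qed

definition projective_norm :: "('a::real_normed_vector, 'b::real_normed_vector) tensor \<Rightarrow> real"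
  where "projective_norm u =
    Inf {\<Sum>(x, y)\<leftarrow>ps. norm x * norm y | ps. u = (\<Sum>(x, y)\<leftarrow>ps. pure_tensor x y)}"

lemma projective_norm_le:
  "projective_norm (\<Sum>(x, y)\<leftarrow>ps. pure_tensor x y) \<le> (\<Sum>(x, y)\<leftarrow>ps. norm x * norm y)"
  unfolding projective_norm_def
  by (rule cInf_lower) (auto intro!: bdd_belowI[of _ 0] sum_list_nonneg)

lemma projective_norm_ge:
  assumes "\<And>ps. u = (\<Sum>(x, y)\<leftarrow>ps. pure_tensor x y) \<Longrightarrow> c \<le> (\<Sum>(x, y)\<leftarrow>ps. norm x * norm y)"
  shows "c \<le> projective_norm u"
  unfolding projective_norm_def
  by (rule cInf_greatest) (use assms tensor_eq_sum_list[of u] in auto)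

lemma projective_norm_nonneg: "0 \<le> projective_norm u"
  by (rule projective_norm_ge) (auto intro!: sum_list_nonneg)

lemma projective_norm_zero:
  "projective_norm (0 :: ('a::real_normed_vector, 'b::real_normed_vector) tensor) = 0"
  using projective_norm_le[of "[] :: ('a \<times> 'b) list"]
    projective_norm_nonneg[of "0 :: ('a, 'b) tensor"]
  by simp

lemma projective_norm_triangle:
  "projective_norm (u + v) \<le> projective_norm u + projective_norm v"
proof -
  have "projective_norm (u + v) - (\<Sum>(x, y)\<leftarrow>ps. norm x * norm y) \<le> projective_norm v"
    if ps: "u = (\<Sum>(x, y)\<leftarrow>ps. pure_tensor x y)" for ps
  proof (rule projective_norm_ge)
    fix qs assume "v = (\<Sum>(x, y)\<leftarrow>qs. pure_tensor x y)"
    then show "projective_norm (u + v) - (\<Sum>(x, y)\<leftarrow>ps. norm x * norm y)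
        \<le> (\<Sum>(x, y)\<leftarrow>qs. norm x * norm y)"
      using projective_norm_le[of "ps @ qs"] ps by simp
  qed
  then have "projective_norm (u + v) - projective_norm v \<le> projective_norm u"
    by (intro projective_norm_ge) (simp add: algebra_simps)
  then show ?thesis by simp
qed

lemma projective_norm_scaleR: "projective_norm (c *\<^sub>R u) = \<bar>c\<bar> * projective_norm u"
proof (cases "c = 0")
  case False
  have le: "projective_norm (d *\<^sub>R v) \<le> \<bar>d\<bar> * projective_norm v" if "d \<noteq> 0"
    for d and v :: "('a, 'b) tensor"
  proof -
    have "projective_norm (d *\<^sub>R v) / \<bar>d\<bar> \<le> projective_norm v"
    proof (rule projective_norm_ge)
      fix ps assume ps: "v = (\<Sum>(x, y)\<leftarrow>ps. pure_tensor x y)"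
      let ?qs = "map (\<lambda>(x, y). (d *\<^sub>R x, y)) ps"
      have "d *\<^sub>R v = (\<Sum>(x, y)\<leftarrow>?qs. pure_tensor x y)"
        unfolding ps by (induction ps) (auto simp: scaleR_add_right pure_tensor_scaleR_left)
      moreover have "(\<Sum>(x, y)\<leftarrow>?qs. norm x * norm y) = \<bar>d\<bar> * (\<Sum>(x, y)\<leftarrow>ps. norm x * norm y)"
        by (induction ps) (auto simp: algebra_simps)
      ultimately have "projective_norm (d *\<^sub>R v) \<le> \<bar>d\<bar> * (\<Sum>(x, y)\<leftarrow>ps. norm x * norm y)"
        using projective_norm_le[of ?qs] by simp
      then show "projective_norm (d *\<^sub>R v) / \<bar>d\<bar> \<le> (\<Sum>(x, y)\<leftarrow>ps. norm x * norm y)"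
        using that by (simp add: field_simps)
    qed
    then show ?thesis using that by (simp add: field_simps)
  qed
  have "projective_norm u \<le> \<bar>inverse c\<bar> * projective_norm (c *\<^sub>R u)"
    using le[of "inverse c" "c *\<^sub>R u"] False by simp
  then have "\<bar>c\<bar> * projective_norm u \<le> projective_norm (c *\<^sub>R u)"
    using False by (simp add: field_simps)
  then show ?thesis using le[OF False, of u] by simp
qed (simp add: projective_norm_zero)

lemma projective_norm_minus: "projective_norm (- u) = projective_norm u"
  using projective_norm_scaleR[of "- 1" u] by simp

lemma projective_norm_minus_commute: "projective_norm (u - v) = projective_norm (v - u)"
  using projective_norm_minus[of "u - v"] by simp

lemma projective_norm_triangle_diff:
  "projective_norm (u - w) \<le> projective_norm (u - v) + projective_norm (v - w)"
  using projective_norm_triangle[of "u - v" "v - w"] by simp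

lemma projective_norm_diff_bound:
  "\<bar>projective_norm u - projective_norm v\<bar> \<le> projective_norm (u - v)"
  using projective_norm_triangle[of "u - v" v] projective_norm_triangle[of "v - u" u]
    projective_norm_minus_commute[of u v] by simp


section \<open>The completed projective tensor product\<close>

text \<open>
  The completion with respect to the projective norm consists of the Cauchy sequences of
  tensors modulo the null sequences.  That the projective norm is definite (a consequence of
  Hahn--Banach) is not needed here: norms of limits are well defined for any seminorm.
\<close>

definition projective_Cauchy ::
    "(nat \<Rightarrow> ('a::real_normed_vector, 'b::real_normed_vector) tensor) \<Rightarrow> bool"
  where "projective_Cauchy s \<longleftrightarrow>
    (\<forall>e>0. \<exists>M. \<forall>m\<ge>M. \<forall>n\<ge>M. projective_norm (s m - s n) < e)"

definition projective_null ::
    "(nat \<Rightarrow> ('a::real_normed_vector, 'b::real_normed_vector) tensor) \<Rightarrow> bool"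
  where "projective_null s \<longleftrightarrow> (\<lambda>n. projective_norm (s n)) \<longlonglongrightarrow> 0"

lemma projective_null_zero: "projective_null (\<lambda>_. 0)"
  by (simp add: projective_null_def projective_norm_zero)

lemma projective_null_bound:
  assumes "\<And>n. projective_norm (s n) \<le> g n" "g \<longlonglongrightarrow> 0"
  shows "projective_null s"
  unfolding projective_null_def
  by (rule tendsto_sandwich[OF _ _ tendsto_const assms(2)])
     (simp_all add: projective_norm_nonneg assms(1))

lemma projective_null_add:
  assumes "projective_null s" "projective_null t"
  shows "projective_null (\<lambda>n. s n + t n)"
  using assms projective_norm_triangle
  by (intro projective_null_bound[where g = "\<lambda>n. projective_norm (s n) + projective_norm (t n)"])
     (auto simp: projective_null_def intro!: tendsto_add_zero)

lemma projective_null_scaleR: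
  assumes "projective_null s"
  shows "projective_null (\<lambda>n. c *\<^sub>R s n)"
  using assms by (simp add: projective_null_def projective_norm_scaleR tendsto_mult_right_zero)

lemma projective_null_minus: "projective_null s \<Longrightarrow> projective_null (\<lambda>n. - s n)"
  by (simp add: projective_null_def projective_norm_minus)

lemma projective_Cauchy_const: "projective_Cauchy (\<lambda>_. u)"
  by (simp add: projective_Cauchy_def projective_norm_zero)

lemma projective_Cauchy_add:
  assumes "projective_Cauchy s" "projective_Cauchy t"
  shows "projective_Cauchy (\<lambda>n. s n + t n)"
  unfolding projective_Cauchy_def
proof safe
  fix e :: real assume "0 < e"
  then obtain M N where M: "\<forall>m\<ge>M. \<forall>n\<ge>M. projective_norm (s m - s n) < e/2"
    and N: "\<forall>m\<ge>N. \<forall>n\<ge>N. projective_norm (t m - t n) < e/2"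
    using assms unfolding projective_Cauchy_def by (meson half_gt_zero)
  have "projective_norm (s m + t m - (s n + t n)) < e" if "m \<ge> max M N" "n \<ge> max M N" for m n
  proof -
    have "projective_norm (s m - s n) < e/2" "projective_norm (t m - t n) < e/2"
      using M N that by auto
    then show ?thesis
      using projective_norm_triangle[of "s m - s n" "t m - t n"] by (simp add: algebra_simps)
  qed
  then show "\<exists>M. \<forall>m\<ge>M. \<forall>n\<ge>M. projective_norm (s m + t m - (s n + t n)) < e" by blast
qed

lemma projective_Cauchy_scaleR:
  assumes "projective_Cauchy s"
  shows "projective_Cauchy (\<lambda>n. c *\<^sub>R s n)"
  unfolding projective_Cauchy_def
proof safe
  fix e :: real assume e: "0 < e"
  then have "0 < e / (\<bar>c\<bar> + 1)" by (simp add: add_nonneg_pos)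
  then obtain M where M: "\<forall>m\<ge>M. \<forall>n\<ge>M. projective_norm (s m - s n) < e / (\<bar>c\<bar> + 1)"
    using assms unfolding projective_Cauchy_def by meson
  have "projective_norm (c *\<^sub>R s m - c *\<^sub>R s n) < e" if "m \<ge> M" "n \<ge> M" for m n
  proof -
    have "projective_norm (c *\<^sub>R s m - c *\<^sub>R s n) = \<bar>c\<bar> * projective_norm (s m - s n)"
      by (simp add: scaleR_diff_right[symmetric] projective_norm_scaleR)
    also have "\<dots> \<le> (\<bar>c\<bar> + 1) * projective_norm (s m - s n)"
      by (intro mult_right_mono) (auto simp: projective_norm_nonneg)
    also have "\<dots> < e" using M that by (simp add: pos_less_divide_eq add_nonneg_pos mult.commute)
    finally show ?thesis .
  qed
  then show "\<exists>M. \<forall>m\<ge>M. \<forall>n\<ge>M. projective_norm (c *\<^sub>R s m - c *\<^sub>R s n) < e" by blast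
qed

lemma projective_Cauchy_minus: "projective_Cauchy s \<Longrightarrow> projective_Cauchy (\<lambda>n. - s n)"
  using projective_Cauchy_scaleR[of s "- 1"] by simp

lemma projective_Cauchy_diff:
  "projective_Cauchy s \<Longrightarrow> projective_Cauchy t \<Longrightarrow> projective_Cauchy (\<lambda>n. s n - t n)"
  using projective_Cauchy_add[OF _ projective_Cauchy_minus] by fastforce

lemma projective_Cauchy_convergent_norm:
  assumes "projective_Cauchy s"
  shows "(\<lambda>n. projective_norm (s n)) \<longlonglongrightarrow> lim (\<lambda>n. projective_norm (s n))"
proof -
  have "Cauchy (\<lambda>n. projective_norm (s n))"
    unfolding Cauchy_def dist_real_def
    using assms projective_norm_diff_bound unfolding projective_Cauchy_def
    by (meson le_less_trans)
  then show ?thesis by (simp add: Cauchy_convergent_iff convergent_LIMSEQ_iff)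
qed

quotient_type (overloaded) ('a, 'b) ptensor =
    "nat \<Rightarrow> ('a::real_normed_vector, 'b::real_normed_vector) tensor" / partial:
    "\<lambda>s t. projective_Cauchy s \<and> projective_Cauchy t \<and> projective_null (\<lambda>n. s n - t n)"
  morphisms Rep_ptensor ptensor_class
proof (rule part_equivpI)
  show "\<exists>s :: nat \<Rightarrow> ('a, 'b) tensor.
      projective_Cauchy s \<and> projective_Cauchy s \<and> projective_null (\<lambda>n. s n - s n)"
    by (rule exI[of _ "\<lambda>_. 0"]) (simp add: projective_Cauchy_const projective_null_zero)
  show "symp (\<lambda>s t :: nat \<Rightarrow> ('a, 'b) tensor.
      projective_Cauchy s \<and> projective_Cauchy t \<and> projective_null (\<lambda>n. s n - t n))"
    by (rule sympI) (auto dest: projective_null_minus)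
  show "transp (\<lambda>s t :: nat \<Rightarrow> ('a, 'b) tensor.
      projective_Cauchy s \<and> projective_Cauchy t \<and> projective_null (\<lambda>n. s n - t n))"
    by (rule transpI) (auto dest: projective_null_add)
qed

instantiation ptensor :: (real_normed_vector, real_normed_vector) real_vector
begin

lift_definition zero_ptensor :: "('a, 'b) ptensor" is "\<lambda>_. 0"
  by (simp add: projective_Cauchy_const projective_null_zero)

lift_definition plus_ptensor :: "('a, 'b) ptensor \<Rightarrow> ('a, 'b) ptensor \<Rightarrow> ('a, 'b) ptensor"
  is "\<lambda>s t n. s n + t n"
  by (auto simp: add_diff_add intro: projective_Cauchy_add projective_null_add)

lift_definition uminus_ptensor :: "('a, 'b) ptensor \<Rightarrow> ('a, 'b) ptensor" is "\<lambda>s n. - s n"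
  by (auto dest: projective_null_minus intro: projective_Cauchy_minus)

lift_definition minus_ptensor :: "('a, 'b) ptensor \<Rightarrow> ('a, 'b) ptensor \<Rightarrow> ('a, 'b) ptensor"
  is "\<lambda>s t n. s n - t n"
proof -
  fix s s' t t' :: "nat \<Rightarrow> ('a, 'b) tensor"
  assume *: "projective_Cauchy s \<and> projective_Cauchy s' \<and> projective_null (\<lambda>n. s n - s' n)"
    "projective_Cauchy t \<and> projective_Cauchy t' \<and> projective_null (\<lambda>n. t n - t' n)"
  then have "projective_null (\<lambda>n. (s n - s' n) + - (t n - t' n))"
    by (intro projective_null_add projective_null_minus) auto
  with * show "projective_Cauchy (\<lambda>n. s n - t n) \<and> projective_Cauchy (\<lambda>n. s' n - t' n)
      \<and> projective_null (\<lambda>n. s n - t n - (s' n - t' n))"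
    by (auto intro: projective_Cauchy_diff simp: algebra_simps)
qed

lift_definition scaleR_ptensor :: "real \<Rightarrow> ('a, 'b) ptensor \<Rightarrow> ('a, 'b) ptensor"
  is "\<lambda>c s n. c *\<^sub>R s n"
  by (auto simp: scaleR_diff_right[symmetric]
      intro: projective_Cauchy_scaleR projective_null_scaleR)

instance
  by standard (transfer; simp add: algebra_simps projective_null_zero projective_Cauchy_const
    projective_Cauchy_add projective_Cauchy_diff projective_Cauchy_scaleR
    projective_Cauchy_minus)+

end

instantiation ptensor :: (real_normed_vector, real_normed_vector) real_normed_vector
begin

lift_definition norm_ptensor :: "('a, 'b) ptensor \<Rightarrow> real"
  is "\<lambda>s. lim (\<lambda>n. projective_norm (s n))"
proof -
  fix s t :: "nat \<Rightarrow> ('a, 'b) tensor"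
  assume *: "projective_Cauchy s \<and> projective_Cauchy t \<and> projective_null (\<lambda>n. s n - t n)"
  have "(\<lambda>n. projective_norm (s n) - projective_norm (t n)) \<longlonglongrightarrow> 0"
    by (rule Lim_null_comparison[where g = "\<lambda>n. projective_norm (s n - t n)"])
       (use * in \<open>auto simp: projective_null_def projective_norm_diff_bound\<close>)
  moreover have "(\<lambda>n. projective_norm (s n) - projective_norm (t n))
      \<longlonglongrightarrow> lim (\<lambda>n. projective_norm (s n)) - lim (\<lambda>n. projective_norm (t n))"
    using * by (intro tendsto_diff projective_Cauchy_convergent_norm) auto
  ultimately show "lim (\<lambda>n. projective_norm (s n)) = lim (\<lambda>n. projective_norm (t n))"
    using LIMSEQ_unique by fastforce
qed

definition dist_ptensor :: "('a, 'b) ptensor \<Rightarrow> ('a, 'b) ptensor \<Rightarrow> real"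
  where "dist_ptensor x y = norm (x - y)"

definition sgn_ptensor :: "('a, 'b) ptensor \<Rightarrow> ('a, 'b) ptensor"
  where "sgn_ptensor x = x /\<^sub>R norm x"

definition uniformity_ptensor :: "(('a, 'b) ptensor \<times> ('a, 'b) ptensor) filter"
  where "uniformity_ptensor = (INF e\<in>{0<..}. principal {(x, y). dist x y < e})"

definition open_ptensor :: "('a, 'b) ptensor set \<Rightarrow> bool"
  where "open_ptensor U = (\<forall>x\<in>U. \<forall>\<^sub>F (x', y) in uniformity. x' = x \<longrightarrow> y \<in> U)"

instance
proof
  fix x y :: "('a, 'b) ptensor" and c :: real
  show "dist x y = norm (x - y)" by (rule dist_ptensor_def)
  show "sgn x = x /\<^sub>R norm x" by (rule sgn_ptensor_def)
  show "uniformity = (INF e\<in>{0<..}. principal {(x, y :: ('a, 'b) ptensor). dist x y < e})"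
    by (rule uniformity_ptensor_def)
  show "open U = (\<forall>x\<in>U. \<forall>\<^sub>F (x', y) in uniformity. x' = x \<longrightarrow> y \<in> U)"
    for U :: "('a, 'b) ptensor set"
    by (rule open_ptensor_def)
  show "norm x = 0 \<longleftrightarrow> x = 0"
  proof transfer
    fix s :: "nat \<Rightarrow> ('a, 'b) tensor"
    assume "projective_Cauchy s \<and> projective_Cauchy s \<and> projective_null (\<lambda>n. s n - s n)"
    then have s: "projective_Cauchy s" by simp
    have "lim (\<lambda>n. projective_norm (s n)) = 0 \<longleftrightarrow> projective_null s"
      unfolding projective_null_def
      using projective_Cauchy_convergent_norm[OF s] LIMSEQ_unique by auto
    then show "lim (\<lambda>n. projective_norm (s n)) = 0 \<longleftrightarrow>
        projective_Cauchy s \<and> projective_Cauchy (\<lambda>_. 0 :: ('a, 'b) tensor)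
        \<and> projective_null (\<lambda>n. s n - 0)"
      by (simp add: s projective_Cauchy_const)
  qed
  show "norm (x + y) \<le> norm x + norm y"
  proof transfer
    fix s t :: "nat \<Rightarrow> ('a, 'b) tensor"
    assume "projective_Cauchy s \<and> projective_Cauchy s \<and> projective_null (\<lambda>n. s n - s n)"
      "projective_Cauchy t \<and> projective_Cauchy t \<and> projective_null (\<lambda>n. t n - t n)"
    then have st: "projective_Cauchy s" "projective_Cauchy t" by auto
    show "lim (\<lambda>n. projective_norm (s n + t n))
        \<le> lim (\<lambda>n. projective_norm (s n)) + lim (\<lambda>n. projective_norm (t n))"
      using projective_Cauchy_convergent_norm[OF projective_Cauchy_add[OF st]]
        tendsto_add[OF projective_Cauchy_convergent_norm[OF st(1)]
          projective_Cauchy_convergent_norm[OF st(2)]]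
      by (rule LIMSEQ_le) (use projective_norm_triangle in blast)
  qed
  show "norm (c *\<^sub>R x) = \<bar>c\<bar> * norm x"
  proof transfer
    fix c :: real and s :: "nat \<Rightarrow> ('a, 'b) tensor"
    assume "projective_Cauchy s \<and> projective_Cauchy s \<and> projective_null (\<lambda>n. s n - s n)"
    then have s: "projective_Cauchy s" by simp
    show "lim (\<lambda>n. projective_norm (c *\<^sub>R s n)) = \<bar>c\<bar> * lim (\<lambda>n. projective_norm (s n))"
      unfolding projective_norm_scaleR
      by (intro limI tendsto_mult tendsto_const projective_Cauchy_convergent_norm s)
  qed
qed

end

definition ptensor_of :: "('a::real_normed_vector, 'b::real_normed_vector) tensor \<Rightarrow>
    ('a, 'b) ptensor"
  where "ptensor_of u = ptensor_class (\<lambda>_. u)"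

lemma norm_ptensor_of: "norm (ptensor_of u) = projective_norm u"
  unfolding ptensor_of_def
  by (subst norm_ptensor.abs_eq) (simp_all add: projective_Cauchy_const projective_null_zero)

lemma ptensor_of_diff: "ptensor_of (u - v) = ptensor_of u - ptensor_of v"
  unfolding ptensor_of_def
  by (subst minus_ptensor.abs_eq) (simp_all add: projective_Cauchy_const projective_null_zero)

lemma ptensor_class_surj: "\<exists>s. projective_Cauchy s \<and> x = ptensor_class s"
  by (metis (mono_tags, lifting) Quotient_ptensor Quotient_abs_rep Quotient_rep_reflp)

lemma ptensor_of_tendsto:
  assumes s: "projective_Cauchy s"
  shows "(\<lambda>n. ptensor_of (s n)) \<longlonglongrightarrow> ptensor_class s"
proof (rule LIMSEQ_I)
  fix r :: real assume "0 < r"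
  then obtain M where M: "\<And>m n. m \<ge> M \<Longrightarrow> n \<ge> M \<Longrightarrow> projective_norm (s m - s n) < r/2"
    using s unfolding projective_Cauchy_def by (meson half_gt_zero)
  have "norm (ptensor_of (s m) - ptensor_class s) < r" if m: "m \<ge> M" for m
  proof -
    have c: "projective_Cauchy (\<lambda>n. s m - s n)"
      by (intro projective_Cauchy_diff projective_Cauchy_const s)
    have "ptensor_of (s m) - ptensor_class s = ptensor_class (\<lambda>n. s m - s n)"
      unfolding ptensor_of_def
      by (rule minus_ptensor.abs_eq)
         (simp_all add: eq_onp_def s projective_Cauchy_const projective_null_zero)
    also have "norm \<dots> = lim (\<lambda>n. projective_norm (s m - s n))"
      by (rule norm_ptensor.abs_eq) (simp add: eq_onp_def c projective_null_zero)
    also have "\<dots> \<le> r/2"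
      by (rule LIMSEQ_le_const2[OF projective_Cauchy_convergent_norm[OF c]])
         (use M[OF m] in \<open>auto intro: less_imp_le\<close>)
    finally show ?thesis using \<open>0 < r\<close> by simp
  qed
  then show "\<exists>M. \<forall>m\<ge>M. norm (ptensor_of (s m) - ptensor_class s) < r" by blast
qed

instance ptensor :: (real_normed_vector, real_normed_vector) banach
proof
  fix X :: "nat \<Rightarrow> ('a, 'b) ptensor"
  assume X: "Cauchy X"
  have "\<exists>u. norm (ptensor_of u - X n) < inverse (Suc n)" for n
  proof -
    obtain s where s: "projective_Cauchy s" "X n = ptensor_class s"
      using ptensor_class_surj by blast
    from LIMSEQ_D[OF ptensor_of_tendsto[OF s(1)], of "inverse (Suc n)"] s(2)
    show ?thesis by auto
  qed
  then obtain u where u: "\<And>n. norm (ptensor_of (u n) - X n) < inverse (Suc n)" by metis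
  have lim: "(\<lambda>n. ptensor_of (u n) - X n) \<longlonglongrightarrow> 0"
    by (rule Lim_null_comparison[OF _ LIMSEQ_inverse_real_of_nat])
       (intro always_eventually allI less_imp_le u)
  have "projective_Cauchy u"
    unfolding projective_Cauchy_def
  proof safe
    fix e :: real assume e: "0 < e"
    obtain M where M: "\<And>m n. m \<ge> M \<Longrightarrow> n \<ge> M \<Longrightarrow> norm (X m - X n) < e/3"
      using CauchyD[OF X, of "e/3"] e by auto
    obtain N where N: "\<And>n. n \<ge> N \<Longrightarrow> norm (ptensor_of (u n) - X n) < e/3"
      using LIMSEQ_D[OF lim, of "e/3"] e by auto
    have "projective_norm (u m - u n) < e" if "m \<ge> max M N" "n \<ge> max M N" for m n
    proof -
      have "ptensor_of (u m - u n)
          = (ptensor_of (u m) - X m) + (X m - X n) - (ptensor_of (u n) - X n)"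
        by (simp add: ptensor_of_diff)
      then have "projective_norm (u m - u n) \<le>
          norm (ptensor_of (u m) - X m) + norm (X m - X n) + norm (ptensor_of (u n) - X n)"
        unfolding norm_ptensor_of[symmetric]
        by (metis (no_types) add_right_mono norm_triangle_ineq norm_triangle_ineq4 order_trans)
      with M[of m n] N[of m] N[of n] that show ?thesis by auto
    qed
    then show "\<exists>M. \<forall>m\<ge>M. \<forall>n\<ge>M. projective_norm (u m - u n) < e" by blast
  qed
  from tendsto_diff[OF ptensor_of_tendsto[OF this] lim] have "X \<longlonglongrightarrow> ptensor_class u" by simp
  then show "convergent X" by (auto simp: convergent_def)
qed

end

theory Submission
  imports Defs
begin

text \<open>
  All three embeddings come from one principle.  Let \<beta> : U \<rightarrow> A be a linear contraction.  A linear
  contraction S : A \<rightarrow> U^{**} with S(x)(\<psi> \<circ> \<beta>) = \<psi>(x) for all \<psi> \<in> A^* is isometric: choose \<psi>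
  of norm at most 1 with \<psi>(x) = \<parallel>x\<parallel> (\<open>bidual_lifting_isometric\<close>).  It remains to lift
  three maps in this sense, namely the barycentre map from the free space onto X, the quotient
  map onto the positively homogeneous free space, and the tensor product of the barycentre maps
  of X and Y.

  The nonlinear embedding \<delta> is made additive by averaging its increments over the group (X, +)
  (\<open>bidual_lifting_barycentre\<close>), and positively homogeneous
  by averaging its rescalings over the group of positive reals (\<open>bidual_lifting_ph_free\<close>).
  The averages need a translation invariant mean on bounded continuous functions; they
  exist only as functionals of \<phi>, hence the biduals.  The tensor product is lifted by applying
  the liftings of the factors successively to the two arguments of a bilinear form
  (\<open>bidual_lifting_ptensor\<close>).

  The invariant means and the norming functionals both follow from a Hahn--Banach theorem
  invariant under commuting contractions (\<open>invariant_Hahn_Banach\<close>), proved through minimal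
  sublinear functionals.  The maps \<beta> and S themselves are built from the universal properties
  of the free space (\<open>lip_free_extension\<close>) and of the completed projective tensor product
  (\<open>ptensor_extension\<close>).
\<close>

section \<open>Hahn--Banach extension invariant under commuting contractions\<close>

text \<open>
  Positive homogeneity is required only as an inequality for c > 0; subadditivity then gives
  the equality, and the weaker form is what infima of sublinear functionals satisfy most directly.
\<close>

definition invariant_sublinear :: "('v::real_vector \<Rightarrow> 'v) set \<Rightarrow> ('v \<Rightarrow> real) \<Rightarrow> bool"
  where "invariant_sublinear G q \<longleftrightarrow>
    (\<forall>x y. q (x + y) \<le> q x + q y) \<and> (\<forall>c>0. \<forall>x. q (c *\<^sub>R x) \<le> c * q x) \<and>
    (\<forall>g\<in>G. \<forall>x. q (g x) \<le> q x)"

lemma invariant_sublinear_add: "invariant_sublinear G q \<Longrightarrow> q (x + y) \<le> q x + q y"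
  and invariant_sublinear_scaleR_le: "invariant_sublinear G q \<Longrightarrow> 0 < c \<Longrightarrow> q (c *\<^sub>R x) \<le> c * q x"
  and invariant_sublinear_invariant: "invariant_sublinear G q \<Longrightarrow> g \<in> G \<Longrightarrow> q (g x) \<le> q x"
  by (auto simp: invariant_sublinear_def)

lemma invariant_sublinear_zero:
  assumes "invariant_sublinear G q"
  shows "q 0 = 0"
  using invariant_sublinear_add[OF assms, of 0 0] invariant_sublinear_scaleR_le[OF assms, of "1/2" 0]
  by simp

lemma invariant_sublinear_scaleR:
  assumes q: "invariant_sublinear G q" and c: "0 \<le> c"
  shows "q (c *\<^sub>R x) = c * q x"
proof (cases "c = 0")
  case False
  with c have c: "0 < c" by simp
  have "q x \<le> inverse c * q (c *\<^sub>R x)"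
    using invariant_sublinear_scaleR_le[OF q, of "inverse c" "c *\<^sub>R x"] c by simp
  then show ?thesis
    using invariant_sublinear_scaleR_le[OF q c, of x] c by (simp add: field_simps)
qed (simp add: invariant_sublinear_zero[OF q])

lemma invariant_sublinear_lower:
  assumes "invariant_sublinear G q"
  shows "- q (- x) \<le> q x"
  using invariant_sublinear_add[OF assms, of x "- x"] invariant_sublinear_zero[OF assms] by simp

text \<open>
  Zorn's lemma for the reversed pointwise order.  The pointwise infimum of a chain is finite
  because every member q \<le> p satisfies q(v) \<ge> -q(-v) \<ge> -p(-v), and it is subadditive because
  any two members of a chain have a common lower bound in it.
\<close>

lemma minimal_invariant_sublinear:
  fixes p :: "'v::real_vector \<Rightarrow> real"
  assumes p: "invariant_sublinear G p"
  obtains q where "invariant_sublinear G q" "q \<le> p"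
    "\<And>r. invariant_sublinear G r \<Longrightarrow> r \<le> q \<Longrightarrow> r = q"
proof -
  define A where "A = {q. invariant_sublinear G q \<and> q \<le> p}"
  have "\<exists>m\<in>A. \<forall>a\<in>A. a \<le> m \<longrightarrow> a = m"
  proof (rule predicate_Zorn[where P = "\<lambda>q r. r \<le> q"])
    show "partial_order_on A (relation_of (\<lambda>q r. r \<le> q) A)"
      by (rule partial_order_on_relation_ofI) auto
  next
    fix C assume C: "C \<in> Chains (relation_of (\<lambda>q r. r \<le> q) A)"
    then have CA: "C \<subseteq> A" and chain: "\<And>q r. q \<in> C \<Longrightarrow> r \<in> C \<Longrightarrow> q \<le> r \<or> r \<le> q"
      by (auto simp: Chains_def relation_of_def)
    show "\<exists>u\<in>A. \<forall>a\<in>C. u \<le> a"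
    proof (cases "C = {}")
      case True
      then show ?thesis using p by (auto simp: A_def)
    next
      case ne: False
      define u where "u = (\<lambda>v. INF q\<in>C. q v)"
      have bdd: "bdd_below ((\<lambda>q. q v) ` C)" for v
      proof (rule bdd_belowI2)
        fix q assume "q \<in> C"
        then have "invariant_sublinear G q" "q \<le> p" using CA by (auto simp: A_def)
        then show "- p (- v) \<le> q v"
          using invariant_sublinear_lower[of G q v] by (force simp: le_fun_def dest: spec[of _ "- v"])
      qed
      have le: "u v \<le> q v" if "q \<in> C" for q v
        unfolding u_def by (rule cINF_lower[OF bdd that])
      have ge: "c \<le> u v" if "\<And>q. q \<in> C \<Longrightarrow> c \<le> q v" for c v
        unfolding u_def by (rule cINF_greatest[OF ne that])
      have sub: "invariant_sublinear G q" if "q \<in> C" for q using CA that by (auto simp: A_def)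
      have "invariant_sublinear G u"
        unfolding invariant_sublinear_def
      proof (intro conjI allI impI ballI)
        fix x y
        have *: "u (x + y) \<le> q x + r y" if qr: "q \<in> C" "r \<in> C" for q r
        proof -
          obtain s where s: "s \<in> C" "s \<le> q" "s \<le> r" using chain[OF qr] qr by blast
          have "u (x + y) \<le> s x + s y"
            using le[OF s(1)] invariant_sublinear_add[OF sub[OF s(1)]] order_trans by blast
          then show ?thesis using le_funD[OF s(2), of x] le_funD[OF s(3), of y] by simp
        qed
        have "u (x + y) - r y \<le> u x" if "r \<in> C" for r
          by (rule ge) (use * that in \<open>force simp: algebra_simps\<close>)
        then have "u (x + y) - u x \<le> u y"
          by (intro ge) (force simp: algebra_simps)
        then show "u (x + y) \<le> u x + u y" by simp
      next
        fix c :: real and x assume c: "0 < c"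
        have "u (c *\<^sub>R x) / c \<le> u x"
        proof (rule ge)
          fix q assume "q \<in> C"
          then have "u (c *\<^sub>R x) \<le> c * q x"
            using le invariant_sublinear_scaleR_le[OF sub _] c order_trans by blast
          then show "u (c *\<^sub>R x) / c \<le> q x" using c by (simp add: field_simps)
        qed
        then show "u (c *\<^sub>R x) \<le> c * u x" using c by (simp add: field_simps)
      next
        fix g x assume g: "g \<in> G"
        show "u (g x) \<le> u x"
          by (rule ge) (meson le invariant_sublinear_invariant sub g order_trans)
      qed
      moreover have "u \<le> p"
      proof -
        obtain q where "q \<in> C" using ne by blast
        then show ?thesis using le[of q] CA by (auto simp: A_def le_fun_def intro: order_trans)
      qed
      ultimately show ?thesis using le by (auto simp: A_def le_fun_def)
    qed
  qed
  then show ?thesis using that unfolding A_def by (metis (mono_tags) mem_Collect_eq order_trans)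
qed

text \<open>
  Replacing q by x \<mapsto> inf_{t \<ge> 0} (q(x + ta) - t q(a)) pushes q down as far as possible in the
  direction -a.  Invariance survives because a is fixed.  At x = -a the last bound
  reads r(-a) \<le> -q(a), so that every linear functional below r is at least q(a) at a.
\<close>

lemma invariant_sublinear_tilt:
  fixes q :: "'v::real_vector \<Rightarrow> real"
  assumes q: "invariant_sublinear G q" and G: "\<And>g. g \<in> G \<Longrightarrow> linear g" "\<And>g. g \<in> G \<Longrightarrow> g a = a"
  obtains r where "invariant_sublinear G r" "r \<le> q" "\<And>x. r x \<le> q (x + a) - q a"
proof -
  define r where "r = (\<lambda>x. INF t\<in>{0..}. q (x + t *\<^sub>R a) - t * q a)"
  have bdd: "bdd_below ((\<lambda>t. q (x + t *\<^sub>R a) - t * q a) ` {0..})" for x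
  proof (rule bdd_belowI2)
    fix t :: real assume "t \<in> {0..}"
    then have "t * q a \<le> q (x + t *\<^sub>R a) + q (- x)"
      using invariant_sublinear_add[OF q, of "x + t *\<^sub>R a" "- x"] invariant_sublinear_scaleR[OF q, of t a]
      by simp
    then show "- q (- x) \<le> q (x + t *\<^sub>R a) - t * q a" by simp
  qed
  have le: "r x \<le> q (x + t *\<^sub>R a) - t * q a" if "0 \<le> t" for x t
    unfolding r_def by (rule cINF_lower[OF bdd]) (use that in simp)
  have ge: "c \<le> r x" if "\<And>t. 0 \<le> t \<Longrightarrow> c \<le> q (x + t *\<^sub>R a) - t * q a" for c x
    unfolding r_def by (rule cINF_greatest) (use that in auto)
  have "invariant_sublinear G r"
    unfolding invariant_sublinear_def
  proof (intro conjI allI impI ballI)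
    fix x y
    have *: "r (x + y) \<le> (q (x + s *\<^sub>R a) - s * q a) + (q (y + t *\<^sub>R a) - t * q a)"
      if "0 \<le> s" "0 \<le> t" for s t
      using le[of "s + t" "x + y"] invariant_sublinear_add[OF q, of "x + s *\<^sub>R a" "y + t *\<^sub>R a"] that
      by (simp add: algebra_simps)
    have "r (x + y) - (q (y + t *\<^sub>R a) - t * q a) \<le> r x" if "0 \<le> t" for t
      by (rule ge) (use *[OF _ that] in \<open>force simp: algebra_simps\<close>)
    then have "r (x + y) - r x \<le> r y"
      by (intro ge) (force simp: algebra_simps)
    then show "r (x + y) \<le> r x + r y" by simp
  next
    fix c :: real and x assume c: "0 < c"
    have "r (c *\<^sub>R x) / c \<le> r x"
    proof (rule ge)
      fix t :: real assume t: "0 \<le> t"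
      have "q (c *\<^sub>R x + (c * t) *\<^sub>R a) = c * q (x + t *\<^sub>R a)"
        using invariant_sublinear_scaleR[OF q, of c "x + t *\<^sub>R a"] c by (simp add: scaleR_add_right)
      with le[of "c * t" "c *\<^sub>R x"] have "r (c *\<^sub>R x) \<le> c * (q (x + t *\<^sub>R a) - t * q a)"
        using c t by (simp add: algebra_simps)
      then show "r (c *\<^sub>R x) / c \<le> q (x + t *\<^sub>R a) - t * q a" using c by (simp add: field_simps)
    qed
    then show "r (c *\<^sub>R x) \<le> c * r x" using c by (simp add: field_simps)
  next
    fix g x assume g: "g \<in> G"
    show "r (g x) \<le> r x"
    proof (rule ge)
      fix t :: real assume t: "0 \<le> t"
      have "g (x + t *\<^sub>R a) = g x + t *\<^sub>R a"
        using G[OF g] by (simp add: linear_add linear_scale)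
      then show "r (g x) \<le> q (x + t *\<^sub>R a) - t * q a"
        using le[OF t, of "g x"] invariant_sublinear_invariant[OF q g, of "x + t *\<^sub>R a"] by simp
    qed
  qed
  moreover have "r \<le> q" using le[of 0] by (auto simp: le_fun_def)
  moreover have "r x \<le> q (x + a) - q a" for x using le[of 1 x] by simp
  ultimately show ?thesis by (rule that)
qed

text \<open>
  A minimal sublinear functional coincides with each of its tilts, which forces additivity.
\<close>

lemma linear_below_sublinear:
  fixes p :: "'v::real_vector \<Rightarrow> real"
  assumes "invariant_sublinear G p"
  obtains f where "linear f" "f \<le> p"
proof -
  have "invariant_sublinear {} p" using assms by (simp add: invariant_sublinear_def)
  then obtain q where q: "invariant_sublinear {} q" "q \<le> p"
    and min: "\<And>r. invariant_sublinear {} r \<Longrightarrow> r \<le> q \<Longrightarrow> r = q"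
    using minimal_invariant_sublinear by metis
  have add: "q (x + y) = q x + q y" for x y
  proof -
    obtain r where r: "invariant_sublinear {} r" "r \<le> q" "\<And>x. r x \<le> q (x + y) - q y"
      using invariant_sublinear_tilt[OF q(1), of y] by auto
    have "q x \<le> q (x + y) - q y" using r(3)[of x] min[OF r(1,2)] by simp
    then show ?thesis using invariant_sublinear_add[OF q(1), of x y] by simp
  qed
  have minus: "q (- x) = - q x" for x
    using add[of x "- x"] invariant_sublinear_zero[OF q(1)] by simp
  have "q (c *\<^sub>R x) = c * q x" for c x
  proof (cases "0 \<le> c")
    case False
    then have "q ((- c) *\<^sub>R x) = (- c) * q x"
      by (intro invariant_sublinear_scaleR[OF q(1)]) simp
    then show ?thesis by (simp add: minus)
  qed (rule invariant_sublinear_scaleR[OF q(1)])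
  then have "linear q" by (intro linearI) (auto simp: add)
  then show ?thesis using q(2) that by blast
qed

text \<open>
  Start from the norm tilted at the fixed vector a, and let q be minimal among the
  G-invariant sublinear functionals below it.  For g \<in> G the Cesaro mean
  A = (1/n) \<Sum>_{k<n} g^k commutes with G, so q \<circ> A is again G-invariant and
  lies below q; hence q \<circ> A = q.  But A(v - gv) = (v - g^n v)/n is of norm at most
  2\<parallel>v\<parallel>/n, so q(v - gv) \<le> 0, and any linear functional below q is invariant.
\<close>

theorem invariant_Hahn_Banach:
  fixes G :: "('v::real_normed_vector \<Rightarrow> 'v) set"
  assumes lin: "\<And>g. g \<in> G \<Longrightarrow> linear g"
    and contr: "\<And>g v. g \<in> G \<Longrightarrow> norm (g v) \<le> norm v"
    and commute: "\<And>g h v. g \<in> G \<Longrightarrow> h \<in> G \<Longrightarrow> g (h v) = h (g v)"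
    and fixed: "\<And>g. g \<in> G \<Longrightarrow> g a = a"
  obtains f :: "'v dual" where "norm f \<le> 1" "f a = norm a" "\<And>g v. g \<in> G \<Longrightarrow> f (g v) = f v"
proof -
  have "invariant_sublinear G norm"
    by (auto simp: invariant_sublinear_def norm_triangle_ineq contr)
  then obtain r where r: "invariant_sublinear G r" "r \<le> norm" "\<And>x. r x \<le> norm (x + a) - norm a"
    by (rule invariant_sublinear_tilt) (use lin fixed in auto)
  obtain q where q: "invariant_sublinear G q" "q \<le> r"
    and min: "\<And>s. invariant_sublinear G s \<Longrightarrow> s \<le> q \<Longrightarrow> s = q"
    using minimal_invariant_sublinear[OF r(1)] by metis
  have q_sum: "q (\<Sum>k<n. u k) \<le> (\<Sum>k<n. q (u k))" for u and n :: nat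
  proof (induction n)
    case (Suc n)
    then show ?case using invariant_sublinear_add[OF q(1), of "\<Sum>k<n. u k" "u n"] by simp
  qed (simp add: invariant_sublinear_zero[OF q(1)])
  have coboundary: "q (v - g v) \<le> 0" if g: "g \<in> G" for g v
  proof -
    have pow_lin: "linear (g ^^ k)" for k
      by (induction k)
         (simp_all only: funpow.simps linear_id linear_compose[OF _ lin[OF g]])
    have pow_contr: "norm ((g ^^ k) w) \<le> norm w" for k w
      by (induction k) (auto intro: order_trans contr[OF g])
    have pow_q: "q ((g ^^ k) w) \<le> q w" for k w
      by (induction k) (auto intro: order_trans invariant_sublinear_invariant[OF q(1) g])
    have pow_commute: "(g ^^ k) (h w) = h ((g ^^ k) w)" if "h \<in> G" for h k w
      by (induction k) (auto simp: commute[OF g that])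
    have bound: "real n * q (v - g v) \<le> 2 * norm v" if n: "n > 0" for n
    proof -
      define A where "A = (\<lambda>w. (1 / real n) *\<^sub>R (\<Sum>k<n. (g ^^ k) w))"
      have q_A: "q (A w) \<le> (1 / real n) * (\<Sum>k<n. q ((g ^^ k) w))" for w
        using q_sum[of "\<lambda>k. (g ^^ k) w" n] n
        by (simp add: A_def invariant_sublinear_scaleR[OF q(1)] divide_right_mono)
      have A_le: "q (A w) \<le> q w" for w
      proof -
        have "(\<Sum>k<n. q ((g ^^ k) w)) \<le> real n * q w"
          using sum_mono[of "{..<n}" "\<lambda>k. q ((g ^^ k) w)" "\<lambda>_. q w"] pow_q by simp
        moreover have "real n * q (A w) \<le> (\<Sum>k<n. q ((g ^^ k) w))"
          using q_A[of w] n by (simp add: field_simps)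
        ultimately have "real n * q (A w) \<le> real n * q w" by linarith
        then show ?thesis using n by simp
      qed
      have "linear A"
        unfolding A_def
        by (intro linear_compose_scale_right linear_compose_sum ballI pow_lin)
      have "invariant_sublinear G (\<lambda>w. q (A w))"
        unfolding invariant_sublinear_def
      proof (intro conjI allI impI ballI)
        show "q (A (x + y)) \<le> q (A x) + q (A y)" for x y
          using invariant_sublinear_add[OF q(1)] by (simp add: linear_add[OF \<open>linear A\<close>])
        show "q (A (c *\<^sub>R x)) \<le> c * q (A x)" if "0 < c" for c x
          using invariant_sublinear_scaleR_le[OF q(1) that] by (simp add: linear_scale[OF \<open>linear A\<close>])
        show "q (A (h x)) \<le> q (A x)" if h: "h \<in> G" for h x
        proof -
          have "A (h x) = h (A x)"
            by (simp add: A_def pow_commute[OF h] linear_sum[OF lin[OF h]] linear_scale[OF lin[OF h]])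
          then show ?thesis using invariant_sublinear_invariant[OF q(1) h] by simp
        qed
      qed
      then have "(\<lambda>w. q (A w)) = q" by (rule min) (simp add: le_fun_def A_le)
      then have "q (v - g v) = q (A (v - g v))" by metis
      also have "A (v - g v) = (1 / real n) *\<^sub>R (v - (g ^^ n) v)"
        using sum_lessThan_telescope'[of "\<lambda>k. (g ^^ k) v" n]
        by (simp add: A_def linear_diff[OF pow_lin] funpow_swap1)
      also have "q \<dots> \<le> norm \<dots>" using q(2) r(2) by (meson le_funD order_trans)
      also have "\<dots> \<le> (1 / real n) * (2 * norm v)"
      proof -
        have "norm (v - (g ^^ n) v) \<le> 2 * norm v"
          using norm_triangle_ineq4[of v "(g ^^ n) v"] pow_contr[of n v] by simp
        then show ?thesis unfolding norm_scaleR by (intro mult_mono) auto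
      qed
      finally show ?thesis using n by (simp add: field_simps)
    qed
    show ?thesis
    proof (rule ccontr)
      assume "\<not> q (v - g v) \<le> 0"
      then obtain n where "2 * norm v < real n * q (v - g v)"
        using reals_Archimedean3[of "q (v - g v)"] by auto
      moreover from this have "n > 0" by (cases n) auto
      ultimately show False using bound[of n] by simp
    qed
  qed
  obtain f where f: "linear f" "f \<le> q" using linear_below_sublinear[OF q(1)] by blast
  have f_norm: "f x \<le> norm x" for x using f(2) q(2) r(2) by (meson le_funD order_trans)
  have f_abs: "\<bar>f x\<bar> \<le> norm x" for x
    using f_norm[of x] f_norm[of "- x"] by (simp add: linear_neg[OF f(1)])
  have bl: "bounded_linear f"
    by (intro bounded_linear_intro[of f 1])
       (use f_abs in \<open>auto simp: linear_add[OF f(1)] linear_scale[OF f(1)]\<close>)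
  have inv: "f (g v) = f v" if g: "g \<in> G" for g v
  proof -
    have "f (w - g w) \<le> 0" for w using coboundary[OF g] f(2) by (meson le_funD order_trans)
    from this[of v] this[of "- v"] show ?thesis
      by (simp add: linear_neg[OF lin[OF g]] linear_diff[OF f(1)] linear_neg[OF f(1)])
  qed
  have "f (- a) \<le> - norm a" using f(2) q(2) r(3)[of "- a"]
    by (metis add.left_inverse diff_0 le_funD norm_zero order_trans)
  then have "f a = norm a" using f_norm[of a] by (simp add: linear_neg[OF f(1)])
  show ?thesis
  proof (rule that[of "Blinfun f"])
    show "norm (Blinfun f) \<le> 1"
      by (rule norm_blinfun_bound) (use f_abs in \<open>auto simp: bounded_linear_Blinfun_apply[OF bl]\<close>)
  qed (auto simp: bounded_linear_Blinfun_apply[OF bl] inv \<open>f a = norm a\<close>)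
qed

text \<open>
  The classical norming functional is the case of no operators at all.
\<close>

corollary Hahn_Banach_norming:
  fixes a :: "'v::real_normed_vector"
  obtains f :: "'v dual" where "norm f \<le> 1" "f a = norm a"
  using invariant_Hahn_Banach[of "{}" a] by auto

section \<open>Translation invariant means\<close>

text \<open>
  The translates form a commuting family of contractions of the space of bounded continuous
  functions, and they fix the constant function 1.
\<close>

theorem translation_invariant_mean:
  obtains M :: "('g::real_normed_vector \<Rightarrow>\<^sub>C real) dual"
  where "norm M \<le> 1" "M (const_bcontfun 1) = 1"
    "\<And>f h y. (\<And>x. apply_bcontfun h x = apply_bcontfun f (x + y)) \<Longrightarrow> M h = M f"
proof -
  define \<tau> :: "'g \<Rightarrow> ('g \<Rightarrow>\<^sub>C real) \<Rightarrow> ('g \<Rightarrow>\<^sub>C real)"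
    where "\<tau> y f = Bcontfun (\<lambda>x. apply_bcontfun f (x + y))" for y f
  have \<tau>: "apply_bcontfun (\<tau> y f) x = apply_bcontfun f (x + y)" for y f x
  proof -
    have "continuous_on UNIV (\<lambda>x. apply_bcontfun f (x + y))"
      by (rule continuous_on_compose2[OF continuous_on_apply_bcontfun[of UNIV f]])
         (auto intro!: continuous_intros)
    then have "(\<lambda>x. apply_bcontfun f (x + y)) \<in> bcontfun"
      by (rule bcontfun_normI) (rule norm_bounded)
    then show ?thesis by (simp add: \<tau>_def Bcontfun_inverse)
  qed
  obtain M :: "('g \<Rightarrow>\<^sub>C real) dual" where M: "norm M \<le> 1"
      "M (const_bcontfun 1) = norm (const_bcontfun 1 :: 'g \<Rightarrow>\<^sub>C real)"
      "\<And>g v. g \<in> range \<tau> \<Longrightarrow> M (g v) = M v"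
  proof (rule invariant_Hahn_Banach[of "range \<tau>" "const_bcontfun 1"])
    show "linear g" if "g \<in> range \<tau>" for g
      using that by (auto intro!: linearI bcontfun_eqI simp: \<tau>)
    show "norm (g f) \<le> norm f" if "g \<in> range \<tau>" for g f
      using that by (auto intro!: norm_bound simp: \<tau> simp flip: real_norm_def intro: norm_bounded)
    show "g (h f) = h (g f)" if "g \<in> range \<tau>" "h \<in> range \<tau>" for g h f
      using that by (auto intro!: bcontfun_eqI simp: \<tau> add_ac)
    show "g (const_bcontfun 1) = const_bcontfun 1" if "g \<in> range \<tau>" for g
      using that by (auto intro!: bcontfun_eqI simp: \<tau>)
  qed blast
  have "norm (const_bcontfun 1 :: 'g \<Rightarrow>\<^sub>C real) = 1"
    using norm_bound[of "const_bcontfun 1 :: 'g \<Rightarrow>\<^sub>C real" 1]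
      norm_bounded[of "const_bcontfun 1 :: 'g \<Rightarrow>\<^sub>C real" undefined] by simp
  moreover have "M h = M f" if "\<And>x. apply_bcontfun h x = apply_bcontfun f (x + y)" for f h y
    using M(3)[of "\<tau> y" f] bcontfun_eqI[of h "\<tau> y f"] that by (simp add: \<tau>)
  ultimately show ?thesis using M(1,2) that by metis
qed

text \<open>
  The same mean as a functional on all real functions, meaningful only on bounded continuous
  ones; this frees its uses from the type of bounded continuous functions.
\<close>

lemma translation_invariant_mean_fun:
  obtains M :: "('g::real_normed_vector \<Rightarrow> real) \<Rightarrow> real"
  where "\<And>c. M (\<lambda>_. c) = c"
    "\<And>f b. continuous_on UNIV f \<Longrightarrow> (\<And>x. \<bar>f x\<bar> \<le> b) \<Longrightarrow> \<bar>M f\<bar> \<le> b"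
    "\<And>f h. f \<in> bcontfun \<Longrightarrow> h \<in> bcontfun \<Longrightarrow> M (\<lambda>x. f x + h x) = M f + M h"
    "\<And>f c. f \<in> bcontfun \<Longrightarrow> M (\<lambda>x. c * f x) = c * M f"
    "\<And>f y. f \<in> bcontfun \<Longrightarrow> M (\<lambda>x. f (x + y)) = M f"
proof -
  obtain m :: "('g \<Rightarrow>\<^sub>C real) dual" where m: "norm m \<le> 1" "m (const_bcontfun 1) = 1"
    "\<And>f h y. (\<And>x. apply_bcontfun h x = apply_bcontfun f (x + y)) \<Longrightarrow> m h = m f"
    by (rule translation_invariant_mean) blast
  define M where "M f = m (Bcontfun f)" for f
  show ?thesis
  proof (rule that[of M])
    have "Bcontfun (\<lambda>_ :: 'g. c) = c *\<^sub>R const_bcontfun 1" for c :: real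
      by (rule bcontfun_eqI) (simp add: Bcontfun_inverse const_bcontfun)
    then show "M (\<lambda>_. c) = c" for c by (simp add: M_def blinfun.scaleR_right m(2))
    show "\<bar>M f\<bar> \<le> b" if "continuous_on UNIV f" "\<And>x. \<bar>f x\<bar> \<le> b" for f b
    proof -
      have "f \<in> bcontfun" using that by (intro bcontfun_normI[of f b]) auto
      then have "norm (Bcontfun f) \<le> b" by (intro norm_bound) (simp add: Bcontfun_inverse that)
      then show ?thesis
        using norm_blinfun[of m "Bcontfun f"] mult_right_mono[OF m(1) norm_ge_zero[of "Bcontfun f"]]
        by (simp add: M_def)
    qed
    show "M (\<lambda>x. f x + h x) = M f + M h" if "f \<in> bcontfun" "h \<in> bcontfun" for f h
    proof -
      have "Bcontfun (\<lambda>x. f x + h x) = Bcontfun f + Bcontfun h"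
        by (rule bcontfun_eqI) (simp add: Bcontfun_inverse plus_cont that)
      then show ?thesis by (simp add: M_def blinfun.add_right)
    qed
    show "M (\<lambda>x. c * f x) = c * M f" if "f \<in> bcontfun" for f c
    proof -
      have "Bcontfun (\<lambda>x. c * f x) = c *\<^sub>R Bcontfun f"
        using scaleR_cont[OF that, of c] by (intro bcontfun_eqI) (simp add: Bcontfun_inverse that)
      then show ?thesis by (simp add: M_def blinfun.scaleR_right)
    qed
    show "M (\<lambda>x. f (x + y)) = M f" if "f \<in> bcontfun" for f y
    proof -
      have "continuous_on UNIV f" "bounded (range f)" using that by (auto simp: bcontfun_def)
      then have "continuous_on UNIV (\<lambda>x. f (x + y))" "bounded (range (\<lambda>x. f (x + y)))"
        by (auto intro!: continuous_on_compose2[of UNIV f UNIV] continuous_intros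
            elim: bounded_subset)
      then have "(\<lambda>x. f (x + y)) \<in> bcontfun" by (simp add: bcontfun_def)
      then show ?thesis
        unfolding M_def by (intro m(3)[of _ _ y]) (simp add: Bcontfun_inverse that)
    qed
  qed
qed

section \<open>Linearisation of Lipschitz maps on the free space\<close>

lemma lip0_delta_apply: "blinfun_apply (lip0_delta x) f = lip0_apply f x"
  by (simp add: lip0_delta.rep_eq)

lemma norm_lip_free_delta_diff: "norm (lip_free_delta x - lip_free_delta y) \<le> norm (x - y)"
  unfolding norm_lip_free.rep_eq minus_lip_free.rep_eq lip_free_delta.rep_eq
  by (rule norm_blinfun_bound)
     (use lip0_apply_dist_le[of _ x y] in \<open>auto simp: blinfun.diff_left lip0_delta_apply mult.commute\<close>)

lemma lip_free_delta_0 [simp]: "lip_free_delta 0 = 0"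
  by transfer (auto intro!: blinfun_eqI simp: lip0_delta_apply)

lemma continuous_on_lip_free_delta [continuous_intros]:
  assumes "continuous_on S f"
  shows "continuous_on S (\<lambda>x. lip_free_delta (f x))"
proof (rule continuous_on_compose2[OF _ assms subset_UNIV])
  have "1-lipschitz_on UNIV lip_free_delta"
    by (rule lipschitz_onI) (simp_all add: dist_norm norm_lip_free_delta_diff)
  then show "continuous_on UNIV lip_free_delta" by (rule lipschitz_on_continuous_on)
qed

text \<open>
  The embedding into the dual of Lip_0 is isometric, so density of the span of the
  evaluations there is density here.
\<close>

lemma lip_free_density:
  fixes S :: "'a::real_normed_vector lip_free set"
  assumes S: "subspace S" "closed S" and delta: "\<And>x. lip_free_delta x \<in> S"
  shows "m \<in> S"
proof -
  let ?D = "range (lip0_delta :: 'a \<Rightarrow> _)"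
  have sub: "closure (span ?D) \<subseteq> closure (lip_free_embed ` S)"
  proof (rule closure_mono, rule span_minimal)
    show "?D \<subseteq> lip_free_embed ` S"
      using delta by (auto simp flip: lip_free_delta.rep_eq)
    have "linear (lip_free_embed :: 'a lip_free \<Rightarrow> _)"
      by (rule linearI) (simp_all add: plus_lip_free.rep_eq scaleR_lip_free.rep_eq)
    then show "subspace (lip_free_embed ` S)" by (rule linear_subspace_image) (rule S)
  qed
  have "m \<in> closure S"
    unfolding closure_approachable
  proof safe
    fix e :: real assume "0 < e"
    moreover have "lip_free_embed m \<in> closure (lip_free_embed ` S)"
      using sub lip_free_embed[of m] by blast
    ultimately obtain n where "n \<in> S" "dist (lip_free_embed n) (lip_free_embed m) < e"
      unfolding closure_approachable by blast
    then show "\<exists>n\<in>S. dist n m < e"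
      by (auto simp: dist_norm norm_lip_free.rep_eq minus_lip_free.rep_eq)
  qed
  then show ?thesis using S(2) by simp
qed

lemma lip0_apply_Lip0:
  assumes "C-lipschitz_on UNIV f" "f 0 = 0"
  shows "lip0_apply (Lip0 f) = f"
  using assms by (intro Lip0_inverse) auto

text \<open>
  A total linear relation along which norms grow by at most the factor C is the graph of a
  bounded operator.  Operators on closures, quotients and completions arise in this way: one
  relates each element to the values computed from its representatives.
\<close>

lemma blinfun_of_linear_graph:
  fixes R :: "'a::real_normed_vector \<Rightarrow> 'b::real_normed_vector \<Rightarrow> bool"
  assumes add: "\<And>m n u v. R m u \<Longrightarrow> R n v \<Longrightarrow> R (m + n) (u + v)"
    and scale: "\<And>c m u. R m u \<Longrightarrow> R (c *\<^sub>R m) (c *\<^sub>R u)"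
    and total: "\<And>m. \<exists>v. R m v"
    and bound: "\<And>m v. R m v \<Longrightarrow> norm v \<le> C * norm m" and C: "0 \<le> C"
  obtains L :: "'a \<Rightarrow>\<^sub>L 'b" where "norm L \<le> C" "\<And>m v. R m v \<Longrightarrow> L m = v"
proof -
  obtain L where L: "\<And>m. R m (L m)" using total by metis
  have unique: "u = v" if "R m u" "R m v" for m u v
    using bound[OF add[OF that(1) scale[OF that(2), of "- 1"]]] by simp
  have bl: "bounded_linear L"
  proof (rule bounded_linear_intro)
    show "L (m + n) = L m + L n" for m n by (rule unique[OF L add[OF L L]])
    show "L (c *\<^sub>R m) = c *\<^sub>R L m" for c m by (rule unique[OF L scale[OF L]])
    show "norm (L m) \<le> norm m * C" for m using bound[OF L[of m]] by (simp add: mult.commute)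
  qed
  show ?thesis
  proof (rule that[of "Blinfun L"])
    show "norm (Blinfun L) \<le> C"
      by (rule norm_blinfun_bound) (use bound[OF L] C in \<open>auto simp: bounded_linear_Blinfun_apply[OF bl]\<close>)
    show "Blinfun L m = v" if "R m v" for m v
      by (simp add: bounded_linear_Blinfun_apply[OF bl] unique[OF L that])
  qed
qed

text \<open>
  Each \<psi> \<in> V^* yields the Lipschitz function \<psi> \<circ> g, on which an element m of the free
  space can be evaluated.  Relate m to v \<in> V if m(\<psi> \<circ> g) = \<psi>(v) for all \<psi>.
  Norming functionals give \<parallel>v\<parallel> \<le> C\<parallel>m\<parallel>, and completeness of V shows
  that the elements m related to some v form a closed subspace; it contains every \<delta>_x.
\<close>

theorem lip_free_extension:
  fixes g :: "'a::real_normed_vector \<Rightarrow> 'v::banach"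
  assumes g: "C-lipschitz_on UNIV g" and g0: "g 0 = 0"
  obtains L :: "'a lip_free \<Rightarrow>\<^sub>L 'v" where "norm L \<le> C" "\<And>x. L (lip_free_delta x) = g x"
proof -
  have C: "0 \<le> C" using g by (simp add: lipschitz_on_def)
  define w where "w \<psi> = Lip0 (\<lambda>x. blinfun_apply \<psi> (g x))" for \<psi> :: "'v dual"
  have lip: "(norm \<psi> * C)-lipschitz_on UNIV (\<lambda>x. blinfun_apply \<psi> (g x))" for \<psi>
  proof (rule lipschitz_onI)
    fix x y
    have "norm (blinfun_apply \<psi> (g x - g y)) \<le> norm \<psi> * (C * norm (x - y))"
      using norm_blinfun[of \<psi> "g x - g y"] lipschitz_onD[OF g, of x y]
        mult_left_mono[of "norm (g x - g y)" "C * norm (x - y)" "norm \<psi>"]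
      by (simp add: dist_norm)
    then show "dist (blinfun_apply \<psi> (g x)) (blinfun_apply \<psi> (g y)) \<le> norm \<psi> * C * dist x y"
      by (simp add: dist_norm blinfun.diff_right mult.assoc)
  qed (use C in simp)
  have w_apply: "lip0_apply (w \<psi>) x = blinfun_apply \<psi> (g x)" for \<psi> x
    unfolding w_def using lip0_apply_Lip0[OF lip] g0 by simp
  have w_norm: "norm (w \<psi>) \<le> norm \<psi> * C" for \<psi>
    by (rule lip0_norm_le) (use lip in \<open>simp add: w_apply\<close>)
  define R where "R m v \<longleftrightarrow> (\<forall>\<psi>. lip_free_embed m (w \<psi>) = blinfun_apply \<psi> v)" for m v
  have bound: "norm v \<le> C * norm m" if "R m v" for m v
  proof -
    obtain \<psi> :: "'v dual" where \<psi>: "norm \<psi> \<le> 1" "\<psi> v = norm v" by (rule Hahn_Banach_norming)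
    have "norm v = lip_free_embed m (w \<psi>)" using that \<psi>(2) by (simp add: R_def)
    also have "\<dots> \<le> norm m * norm (w \<psi>)"
      using norm_blinfun[of "lip_free_embed m" "w \<psi>"] by (simp add: norm_lip_free.rep_eq)
    also have "\<dots> \<le> norm m * C"
      using w_norm[of \<psi>] mult_right_mono[OF \<psi>(1) C] by (intro mult_left_mono) auto
    finally show ?thesis by (simp add: mult.commute)
  qed
  have R_add: "R (m + n) (u + v)" if "R m u" "R n v" for m n u v
    using that by (simp add: R_def plus_lip_free.rep_eq blinfun.bilinear_simps)
  have R_scale: "R (c *\<^sub>R m) (c *\<^sub>R u)" if "R m u" for m u c
    using that by (simp add: R_def scaleR_lip_free.rep_eq blinfun.bilinear_simps)
  have R_diff: "R (m - n) (u - v)" if "R m u" "R n v" for m n u v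
    using that by (simp add: R_def minus_lip_free.rep_eq blinfun.bilinear_simps)
  have R_delta: "R (lip_free_delta x) (g x)" for x
    by (simp add: R_def lip_free_delta.rep_eq lip0_delta_apply w_apply)
  have "m \<in> {m. \<exists>v. R m v}" for m
  proof (rule lip_free_density)
    show "subspace {m. \<exists>v. R m v}"
    proof (rule subspaceI)
      show "0 \<in> {m. \<exists>v. R m v}" using R_delta[of 0] by auto
    qed (use R_add R_scale in blast)+
    show "closed {m. \<exists>v. R m v}"
      unfolding closed_sequential_limits
    proof safe
      fix s l assume "\<forall>n. s n \<in> {m. \<exists>v. R m v}" and l: "s \<longlonglongrightarrow> l"
      then obtain v where v: "\<And>n. R (s n) (v n)" by (auto simp: choice_iff)
      have "Cauchy v"
      proof (rule CauchyI)
        fix e :: real assume e: "0 < e"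
        then have "0 < e / (C + 1)" using C by simp
        from CauchyD[OF LIMSEQ_imp_Cauchy[OF l] this] obtain N
          where N: "\<And>m n. m \<ge> N \<Longrightarrow> n \<ge> N \<Longrightarrow> norm (s m - s n) < e / (C + 1)" by blast
        have "norm (v m - v n) < e" if "m \<ge> N" "n \<ge> N" for m n
        proof -
          have "norm (v m - v n) \<le> C * norm (s m - s n)" by (intro bound R_diff v)
          also have "\<dots> \<le> (C + 1) * norm (s m - s n)" by (intro mult_right_mono) auto
          also have "\<dots> < e" using N[OF that] C by (simp add: field_simps)
          finally show ?thesis .
        qed
        then show "\<exists>N. \<forall>m\<ge>N. \<forall>n\<ge>N. norm (v m - v n) < e" by blast
      qed
      then obtain v' where v': "v \<longlonglongrightarrow> v'" by (auto simp: Cauchy_convergent_iff convergent_def)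
      have s': "(\<lambda>n. lip_free_embed (s n)) \<longlonglongrightarrow> lip_free_embed l"
        using l by (simp add: LIMSEQ_def dist_norm norm_lip_free.rep_eq minus_lip_free.rep_eq)
      have "R l v'"
        unfolding R_def
      proof
        fix \<psi>
        have "(\<lambda>n. lip_free_embed (s n) (w \<psi>)) \<longlonglongrightarrow> lip_free_embed l (w \<psi>)"
          by (intro tendsto_intros s')
        moreover have "(\<lambda>n. blinfun_apply \<psi> (v n)) \<longlonglongrightarrow> blinfun_apply \<psi> v'"
          by (intro tendsto_intros v')
        ultimately show "lip_free_embed l (w \<psi>) = blinfun_apply \<psi> v'"
          using v by (auto simp: R_def intro: LIMSEQ_unique)
      qed
      then show "\<exists>v. R l v" by blast
    qed
  qed (use R_delta in blast)
  then have total: "\<exists>v. R m v" for m by simp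
  obtain L where L: "norm L \<le> C" "\<And>m v. R m v \<Longrightarrow> blinfun_apply L m = v"
    using blinfun_of_linear_graph[of R C, OF R_add R_scale total bound C] by blast
  then show ?thesis using that R_delta by blast
qed

section \<open>Contractive liftings into biduals\<close>

text \<open>
  The identity says that \<beta>^{**} \<circ> S is the canonical embedding of the target of \<beta> into its
  bidual: up to passing to biduals, S is a linear contractive right inverse of \<beta>.
\<close>

definition bidual_lifting ::
    "('u::real_normed_vector \<Rightarrow>\<^sub>L 'a::real_normed_vector) \<Rightarrow> ('a \<Rightarrow>\<^sub>L 'u bidual) \<Rightarrow> bool"
  where "bidual_lifting \<beta> S \<longleftrightarrow> norm \<beta> \<le> 1 \<and> norm S \<le> 1 \<and> (\<forall>x \<psi>. S x (\<psi> o\<^sub>L \<beta>) = \<psi> x)"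

lemma contraction_blinfun_apply:
  assumes "norm f \<le> 1"
  shows "norm (blinfun_apply f x) \<le> norm x"
  using norm_blinfun[of f x] mult_right_mono[OF assms norm_ge_zero[of x]] by simp

text \<open>
  The functional \<psi> \<circ> \<beta>, with \<psi> norming for x, witnesses that S does not decrease the norm.
\<close>

lemma bidual_lifting_isometric:
  assumes "bidual_lifting \<beta> S"
  shows "linear_isometric_embedding (blinfun_apply S)"
  unfolding linear_isometric_embedding_def
proof (intro conjI allI antisym)
  have \<beta>: "norm \<beta> \<le> 1" and S: "norm S \<le> 1" "\<And>x \<psi>. S x (\<psi> o\<^sub>L \<beta>) = \<psi> x"
    using assms by (auto simp: bidual_lifting_def)
  show "linear (blinfun_apply S)"
    by (rule bounded_linear.linear[OF blinfun.bounded_linear_right])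
  show "norm (S x) \<le> norm x" for x
    by (rule contraction_blinfun_apply[OF S(1)])
  show "norm x \<le> norm (S x)" for x
  proof -
    obtain \<psi> where \<psi>: "norm \<psi> \<le> 1" "blinfun_apply \<psi> x = norm x" by (rule Hahn_Banach_norming)
    have "norm (\<psi> o\<^sub>L \<beta>) \<le> norm \<psi> * norm \<beta>" by (rule norm_blinfun_compose)
    also have "\<dots> \<le> 1" using mult_mono[OF \<psi>(1) \<beta>] by simp
    finally have "norm (\<psi> o\<^sub>L \<beta>) \<le> 1" .
    then have "norm (S x) * norm (\<psi> o\<^sub>L \<beta>) \<le> norm (S x)"
      by (rule mult_left_le) simp
    moreover have "norm x \<le> norm (S x) * norm (\<psi> o\<^sub>L \<beta>)"
      using norm_blinfun[of "S x" "\<psi> o\<^sub>L \<beta>"] S(2)[of x \<psi>] \<psi>(2) by simp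
    ultimately show ?thesis by simp
  qed
qed

section \<open>Lifting the barycentre map\<close>

text \<open>
  The defect g(t) = f(tx) - t f(x) is additive in t and vanishes at the integers, so its
  values are those at fractional parts; it is thus bounded, and a bounded additive
  function vanishes.
\<close>

lemma additive_bounded_imp_bounded_linear:
  fixes f :: "'a::real_normed_vector \<Rightarrow> 'b::real_normed_vector"
  assumes add: "\<And>x y. f (x + y) = f x + f y" and bound: "\<And>x. norm (f x) \<le> norm x * K"
  shows "bounded_linear f"
proof (rule bounded_linear_intro[OF add _ bound])
  fix t :: real and x
  define g where "g t = f (t *\<^sub>R x) - t *\<^sub>R f x" for t
  have g_add: "g (s + t) = g s + g t" for s t
    by (simp add: g_def scaleR_add_left add)
  have g_nat: "g (real n * t) = real n *\<^sub>R g t" for n t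
    using add[of 0 0] by (induction n) (auto simp: g_def[of 0] g_add algebra_simps)
  have g_minus: "g (- t) = - g t" for t
    using g_add[of t "- t"] g_nat[of 0 0] by (simp add: add_eq_0_iff)
  have "g 1 = 0" by (simp add: g_def)
  have g_int: "g (of_int k) = 0" for k :: int
    using g_nat[of "nat k" 1] g_nat[of "nat (- k)" 1] g_minus[of "of_int k"] \<open>g 1 = 0\<close>
    by (cases "0 \<le> k") auto
  have g_bound: "norm (g t) \<le> 2 * (norm x * \<bar>K\<bar>)" for t
  proof -
    have frac: "frac t * a \<le> a" if "0 \<le> a" for a
      using mult_right_mono[of "frac t" 1 a] frac_lt_1[of t] that by simp
    have bound': "norm (f y) \<le> norm y * \<bar>K\<bar>" for y
      by (rule order_trans[OF bound mult_left_mono]) auto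
    have "norm (f (frac t *\<^sub>R x)) \<le> norm x * \<bar>K\<bar>"
      using bound'[of "frac t *\<^sub>R x"] frac[of "norm x * \<bar>K\<bar>"] by (simp add: frac_ge_0 mult.assoc)
    moreover have "norm (frac t *\<^sub>R f x) \<le> norm x * \<bar>K\<bar>"
      using bound'[of x] frac[of "norm (f x)"] by (simp add: frac_ge_0)
    moreover have "g t = g (frac t)"
      using g_add[of "of_int \<lfloor>t\<rfloor>" "frac t"] g_int by (simp add: frac_def)
    ultimately show ?thesis
      using norm_triangle_ineq4[of "f (frac t *\<^sub>R x)" "frac t *\<^sub>R f x"] by (simp add: g_def)
  qed
  have "g t = 0"
  proof (rule ccontr)
    assume "g t \<noteq> 0"
    then obtain n where "2 * (norm x * \<bar>K\<bar>) < real n * norm (g t)"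
      using reals_Archimedean3[of "norm (g t)"] by auto
    then show False using g_bound[of "real n * t"] by (simp add: g_nat)
  qed
  then show "f (t *\<^sub>R x) = t *\<^sub>R f x" by (simp add: g_def)
qed

lemma abs_dual_apply_le: "\<bar>blinfun_apply \<phi> m\<bar> \<le> norm \<phi> * norm m" for \<phi> :: "'a::real_normed_vector dual"
  using norm_blinfun[of \<phi> m] by simp

text \<open>
  The map \<beta> is the barycentre map, \<delta>_x \<mapsto> x.  Although x \<mapsto> \<delta>_x is not linear, its increments
  \<delta>_{y + x} - \<delta>_y become additive in x once they are averaged over y by an invariant mean:
  S(x)(\<phi>) is the mean over y of \<phi>(\<delta>_{y + x} - \<delta>_y).  If \<phi> = \<psi> \<circ> \<beta>, the function averaged is
  the constant \<psi>(x).
\<close>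

theorem bidual_lifting_barycentre:
  obtains \<beta> :: "'x::banach lip_free \<Rightarrow>\<^sub>L 'x" and S where "bidual_lifting \<beta> S"
proof -
  obtain \<beta> :: "'x lip_free \<Rightarrow>\<^sub>L 'x" where \<beta>: "norm \<beta> \<le> 1" "\<And>x. \<beta> (lip_free_delta x) = x"
    by (rule lip_free_extension[of 1 "\<lambda>x. x"]) (auto intro: lipschitz_onI)
  obtain M :: "('x \<Rightarrow> real) \<Rightarrow> real" where M_const: "\<And>c. M (\<lambda>_. c) = c"
    and M_bound: "\<And>f b. continuous_on UNIV f \<Longrightarrow> (\<And>x. \<bar>f x\<bar> \<le> b) \<Longrightarrow> \<bar>M f\<bar> \<le> b"
    and M_add: "\<And>f h. f \<in> bcontfun \<Longrightarrow> h \<in> bcontfun \<Longrightarrow> M (\<lambda>x. f x + h x) = M f + M h"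
    and M_scale: "\<And>f c. f \<in> bcontfun \<Longrightarrow> M (\<lambda>x. c * f x) = c * M f"
    and M_shift: "\<And>f y. f \<in> bcontfun \<Longrightarrow> M (\<lambda>x. f (x + y)) = M f"
    by (rule translation_invariant_mean_fun) blast
  define D :: "'x \<Rightarrow> 'x lip_free dual \<Rightarrow> 'x \<Rightarrow> real"
    where "D x \<phi> y = \<phi> (lip_free_delta (y + x) - lip_free_delta y)" for x \<phi> y
  have D_cont: "continuous_on UNIV (D x \<phi>)" for x \<phi>
    unfolding D_def by (intro continuous_intros)
  have D_le: "\<bar>D x \<phi> y\<bar> \<le> norm x * norm \<phi>" for x \<phi> y
  proof -
    have "\<bar>D x \<phi> y\<bar> \<le> norm \<phi> * norm (lip_free_delta (y + x) - lip_free_delta y)"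
      unfolding D_def by (rule abs_dual_apply_le)
    also have "\<dots> \<le> norm \<phi> * norm x"
      using norm_lip_free_delta_diff[of "y + x" y] by (intro mult_left_mono) auto
    finally show ?thesis by (simp add: mult.commute)
  qed
  have D_bcont: "D x \<phi> \<in> bcontfun" for x \<phi>
    by (rule bcontfun_normI[OF D_cont]) (use D_le in auto)
  define s where "s x = Blinfun (\<lambda>\<phi>. M (D x \<phi>))" for x
  have bl: "bounded_linear (\<lambda>\<phi>. M (D x \<phi>))" for x
  proof (rule bounded_linear_intro[of _ "norm x"])
    have "D x (\<phi> + \<psi>) = (\<lambda>y. D x \<phi> y + D x \<psi> y)" "D x (c *\<^sub>R \<phi>) = (\<lambda>y. c * D x \<phi> y)" for \<phi> \<psi> c
      by (simp_all add: D_def fun_eq_iff blinfun.add_left blinfun.scaleR_left)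
    then show "M (D x (\<phi> + \<psi>)) = M (D x \<phi>) + M (D x \<psi>)" "M (D x (c *\<^sub>R \<phi>)) = c *\<^sub>R M (D x \<phi>)" for \<phi> \<psi> c
      by (simp_all add: M_add M_scale D_bcont)
    show "norm (M (D x \<phi>)) \<le> norm \<phi> * norm x" for \<phi>
      using M_bound[OF D_cont D_le] by (simp add: mult.commute)
  qed
  have s_apply: "s x \<phi> = M (D x \<phi>)" for x \<phi>
    by (simp add: s_def bounded_linear_Blinfun_apply[OF bl])
  have s_norm: "norm (s x) \<le> norm x" for x
    by (rule norm_blinfun_bound) (use M_bound[OF D_cont D_le] in \<open>auto simp: s_apply\<close>)
  have "bounded_linear s"
  proof (rule additive_bounded_imp_bounded_linear[where K = 1])
    show "s (x + x') = s x + s x'" for x x'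
    proof (rule blinfun_eqI)
      fix \<phi>
      have "D (x + x') \<phi> = (\<lambda>y. D x \<phi> (y + x') + D x' \<phi> y)"
        by (simp add: D_def fun_eq_iff blinfun.diff_right add_ac)
      moreover have "(\<lambda>y. D x \<phi> (y + x')) \<in> bcontfun"
        using D_le by (intro bcontfun_normI[where b = "norm x * norm \<phi>"])
          (auto intro!: continuous_on_compose2[OF D_cont] continuous_intros)
      ultimately show "s (x + x') \<phi> = (s x + s x') \<phi>"
        using M_add[OF _ D_bcont] M_shift[OF D_bcont] by (simp add: s_apply blinfun.add_left)
    qed
  qed (use s_norm in simp)
  then have S_apply: "blinfun_apply (Blinfun s) = s" by (rule bounded_linear_Blinfun_apply)
  have "norm (Blinfun s) \<le> 1"
    by (rule norm_blinfun_bound) (use s_norm in \<open>auto simp: S_apply\<close>)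
  moreover have "s x (\<psi> o\<^sub>L \<beta>) = \<psi> x" for x \<psi>
  proof -
    have "D x (\<psi> o\<^sub>L \<beta>) = (\<lambda>_. \<psi> x)"
      by (simp add: D_def fun_eq_iff blinfun.diff_right blinfun.add_right \<beta>)
    then show ?thesis by (simp add: s_apply M_const)
  qed
  ultimately have "bidual_lifting \<beta> (Blinfun s)"
    using \<beta>(1) by (simp add: bidual_lifting_def S_apply)
  then show ?thesis by (rule that)
qed

section \<open>Lifting the positively homogeneous quotient\<close>

text \<open>
  The map \<pi> is the quotient map.  Averaging r^{-1}\<phi>(\<delta>_{rx}) over the multiplicative group of
  positive r makes the Lipschitz function x \<mapsto> \<phi>(\<delta>_x) positively homogeneous.  Writing r = e^t turns this into a mean
  over the additive group of the reals.  The resulting 1-Lipschitz map x \<mapsto> s(x) into the bidual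
  extends linearly to the free space, and positive homogeneity of s lets the extension
  factor through the quotient.
\<close>

theorem bidual_lifting_ph_free:
  obtains \<pi> :: "'x::real_normed_vector lip_free \<Rightarrow>\<^sub>L 'x ph_free" and S where "bidual_lifting \<pi> S"
proof -
  have "bounded_linear (ph_free_class :: 'x lip_free \<Rightarrow> _)"
    by (rule bounded_linear_intro[of _ 1])
       (simp_all add: plus_ph_free.abs_eq scaleR_ph_free.abs_eq ph_free_norm_le)
  then have \<pi>: "blinfun_apply (Blinfun (ph_free_class :: 'x lip_free \<Rightarrow> _)) = ph_free_class"
    by (rule bounded_linear_Blinfun_apply)
  define \<pi> where "\<pi> = Blinfun (ph_free_class :: 'x lip_free \<Rightarrow> _)"
  note \<pi> = \<pi>[folded \<pi>_def]
  have \<pi>_norm: "norm \<pi> \<le> 1"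
    by (rule norm_blinfun_bound) (auto simp: \<pi> ph_free_norm_le)
  have \<pi>_delta: "\<pi> (lip_free_delta (r *\<^sub>R x)) = r *\<^sub>R \<pi> (lip_free_delta x)" if "0 < r" for r x
  proof -
    have "lip_free_delta (r *\<^sub>R x) - r *\<^sub>R lip_free_delta x \<in> ph_relations"
      unfolding ph_relations_def
      by (rule subsetD[OF closure_subset], rule span_base) (use that in blast)
    then have "ph_free_class (lip_free_delta (r *\<^sub>R x)) = ph_free_class (r *\<^sub>R lip_free_delta x)"
      by (simp add: ph_free_class_eq_iff)
    then show ?thesis by (simp add: \<pi> scaleR_ph_free.abs_eq)
  qed
  obtain M :: "(real \<Rightarrow> real) \<Rightarrow> real" where M_const: "\<And>c. M (\<lambda>_. c) = c"
    and M_bound: "\<And>f b. continuous_on UNIV f \<Longrightarrow> (\<And>x. \<bar>f x\<bar> \<le> b) \<Longrightarrow> \<bar>M f\<bar> \<le> b"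
    and M_add: "\<And>f h. f \<in> bcontfun \<Longrightarrow> h \<in> bcontfun \<Longrightarrow> M (\<lambda>x. f x + h x) = M f + M h"
    and M_scale: "\<And>f c. f \<in> bcontfun \<Longrightarrow> M (\<lambda>x. c * f x) = c * M f"
    and M_shift: "\<And>f y. f \<in> bcontfun \<Longrightarrow> M (\<lambda>x. f (x + y)) = M f"
    by (rule translation_invariant_mean_fun) blast
  define D :: "'x \<Rightarrow> 'x lip_free dual \<Rightarrow> real \<Rightarrow> real"
    where "D x \<phi> t = exp (- t) * \<phi> (lip_free_delta (exp t *\<^sub>R x))" for x \<phi> t
  have D_cont: "continuous_on UNIV (D x \<phi>)" for x \<phi>
    unfolding D_def by (intro continuous_intros)
  have D_diff_le: "\<bar>D x \<phi> t - D y \<phi> t\<bar> \<le> norm (x - y) * norm \<phi>" for x y \<phi> t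
  proof -
    have "\<bar>\<phi> (lip_free_delta (exp t *\<^sub>R x) - lip_free_delta (exp t *\<^sub>R y))\<bar>
        \<le> norm \<phi> * norm (exp t *\<^sub>R x - exp t *\<^sub>R y)"
      by (rule order_trans[OF abs_dual_apply_le mult_left_mono[OF norm_lip_free_delta_diff]]) simp
    also have "\<dots> = exp t * (norm (x - y) * norm \<phi>)"
      by (simp add: mult_ac flip: scaleR_diff_right)
    finally have "exp (- t) * \<bar>\<phi> (lip_free_delta (exp t *\<^sub>R x) - lip_free_delta (exp t *\<^sub>R y))\<bar>
        \<le> norm (x - y) * norm \<phi>"
      by (simp add: exp_minus field_simps)
    moreover have "D x \<phi> t - D y \<phi> t
        = exp (- t) * \<phi> (lip_free_delta (exp t *\<^sub>R x) - lip_free_delta (exp t *\<^sub>R y))"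
      by (simp add: D_def blinfun.diff_right right_diff_distrib)
    ultimately show ?thesis by (simp add: abs_mult)
  qed
  have D_le: "\<bar>D x \<phi> t\<bar> \<le> norm x * norm \<phi>" for x \<phi> t
    using D_diff_le[of x \<phi> t 0] by (simp add: D_def[of 0])
  have D_bcont: "D x \<phi> \<in> bcontfun" for x \<phi>
    by (rule bcontfun_normI[OF D_cont]) (use D_le in auto)
  define s where "s x = Blinfun (\<lambda>\<phi>. M (D x \<phi>))" for x
  have bl: "bounded_linear (\<lambda>\<phi>. M (D x \<phi>))" for x
  proof (rule bounded_linear_intro[of _ "norm x"])
    have "D x (\<phi> + \<psi>) = (\<lambda>t. D x \<phi> t + D x \<psi> t)" "D x (c *\<^sub>R \<phi>) = (\<lambda>t. c * D x \<phi> t)" for \<phi> \<psi> c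
      by (simp_all add: D_def fun_eq_iff blinfun.add_left blinfun.scaleR_left distrib_left)
    then show "M (D x (\<phi> + \<psi>)) = M (D x \<phi>) + M (D x \<psi>)" "M (D x (c *\<^sub>R \<phi>)) = c *\<^sub>R M (D x \<phi>)" for \<phi> \<psi> c
      by (simp_all add: M_add M_scale D_bcont)
    show "norm (M (D x \<phi>)) \<le> norm \<phi> * norm x" for \<phi>
      using M_bound[OF D_cont D_le] by (simp add: mult.commute)
  qed
  have s_apply: "s x \<phi> = M (D x \<phi>)" for x \<phi>
    by (simp add: s_def bounded_linear_Blinfun_apply[OF bl])
  have s_lip: "1-lipschitz_on UNIV s"
  proof (rule lipschitz_onI)
    fix x y
    have "norm (s x - s y) \<le> norm (x - y)"
    proof (rule norm_blinfun_bound)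
      fix \<phi>
      have "M (\<lambda>t. D x \<phi> t + (- 1) * D y \<phi> t) = M (D x \<phi>) + (- 1) * M (D y \<phi>)"
        using M_add[OF D_bcont, of "\<lambda>t. (- 1) * D y \<phi> t" x \<phi>] M_scale[OF D_bcont, of "- 1" y \<phi>]
          scaleR_cont[OF D_bcont, of "- 1" y \<phi>] by simp
      moreover have "\<bar>M (\<lambda>t. D x \<phi> t + (- 1) * D y \<phi> t)\<bar> \<le> norm (x - y) * norm \<phi>"
        by (rule M_bound) (use D_diff_le in \<open>auto intro!: continuous_intros D_cont\<close>)
      ultimately show "norm ((s x - s y) \<phi>) \<le> norm (x - y) * norm \<phi>"
        by (simp add: s_apply blinfun.diff_left)
    qed simp
    then show "dist (s x) (s y) \<le> 1 * dist x y" by (simp add: dist_norm)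
  qed simp
  have s0: "s 0 = 0"
    by (rule blinfun_eqI) (simp add: s_apply D_def[abs_def] M_const)
  obtain R where R: "norm R \<le> 1" "\<And>x. blinfun_apply R (lip_free_delta x) = s x"
    using lip_free_extension[OF s_lip s0] by metis
  \<comment> \<open>rescaling x by r translates the averaged function by ln r\<close>
  have s_scale: "s (r *\<^sub>R x) = r *\<^sub>R s x" if r: "0 < r" for r x
  proof (rule blinfun_eqI)
    fix \<phi>
    have "D (r *\<^sub>R x) \<phi> = (\<lambda>t. r * D x \<phi> (t + ln r))"
      using r by (simp add: D_def fun_eq_iff exp_add exp_diff exp_minus field_simps)
    moreover have "(\<lambda>t. D x \<phi> (t + ln r)) \<in> bcontfun"
      using D_le by (intro bcontfun_normI[where b = "norm x * norm \<phi>"])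
        (auto intro!: continuous_on_compose2[OF D_cont] continuous_intros)
    ultimately show "s (r *\<^sub>R x) \<phi> = (r *\<^sub>R s x) \<phi>"
      using M_scale M_shift[OF D_bcont] by (simp add: s_apply blinfun.scaleR_left)
  qed
  have R_ph: "R m = 0" if "m \<in> ph_relations" for m
  proof -
    have "ph_relations \<subseteq> {m. R m = 0}"
      unfolding ph_relations_def
    proof (rule closure_minimal, rule span_minimal)
      show "subspace {m. R m = 0}" by (auto simp: subspace_def blinfun.bilinear_simps)
      show "closed {m. R m = 0}" by (intro closed_Collect_eq continuous_intros)
    qed (auto simp: blinfun.bilinear_simps R s_scale)
    with that show ?thesis by blast
  qed
  define Q where "Q q v \<longleftrightarrow> (\<exists>m. q = ph_free_class m \<and> v = R m)" for q v
  obtain S where S: "norm S \<le> 1" "\<And>q v. Q q v \<Longrightarrow> blinfun_apply S q = v"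
  proof (rule blinfun_of_linear_graph[of Q 1])
    show "Q (p + q) (u + v)" if "Q p u" "Q q v" for p q u v
      using that unfolding Q_def by (metis plus_ph_free.abs_eq blinfun.add_right)
    show "Q (c *\<^sub>R q) (c *\<^sub>R v)" if "Q q v" for c q v
      using that unfolding Q_def by (metis scaleR_ph_free.abs_eq blinfun.scaleR_right)
    show "\<exists>v. Q q v" for q using ph_free_class_surj[of q] by (auto simp: Q_def)
    show "norm v \<le> 1 * norm q" if Q: "Q q v" for q v
    proof -
      obtain m where m: "q = ph_free_class m" "v = R m" using Q by (auto simp: Q_def)
      have "norm v \<le> norm q"
      proof (rule ph_free_norm_ge)
        fix n assume "ph_free_class n = q"
        then have "R (n - m) = 0" by (intro R_ph) (simp add: m flip: ph_free_class_eq_iff)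
        then have "v = R n" by (simp add: m blinfun.diff_right)
        then show "norm v \<le> norm n" using contraction_blinfun_apply[OF R(1)] by simp
      qed
      then show ?thesis by simp
    qed
  qed auto
  have "S q (\<psi> o\<^sub>L \<pi>) = \<psi> q" for q \<psi>
  proof -
    obtain m where m: "q = ph_free_class m" using ph_free_class_surj by blast
    have "m \<in> {m. R m (\<psi> o\<^sub>L \<pi>) = \<psi> (\<pi> m)}"
    proof (rule lip_free_density)
      show "subspace {m. R m (\<psi> o\<^sub>L \<pi>) = \<psi> (\<pi> m)}"
        by (auto simp: subspace_def blinfun.bilinear_simps)
      show "closed {m. R m (\<psi> o\<^sub>L \<pi>) = \<psi> (\<pi> m)}"
        by (intro closed_Collect_eq continuous_intros)
      have "D x (\<psi> o\<^sub>L \<pi>) = (\<lambda>_. \<psi> (\<pi> (lip_free_delta x)))" for x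
        by (simp add: D_def fun_eq_iff \<pi>_delta blinfun.scaleR_right flip: exp_add)
      then show "lip_free_delta x \<in> {m. R m (\<psi> o\<^sub>L \<pi>) = \<psi> (\<pi> m)}" for x
        by (simp add: R s_apply M_const)
    qed
    moreover have "S q = R m" using m by (intro S(2)) (auto simp: Q_def)
    ultimately show ?thesis by (simp add: m \<pi>)
  qed
  then have "bidual_lifting \<pi> S" using \<pi>_norm S(1) by (simp add: bidual_lifting_def)
  then show ?thesis by (rule that)
qed

section \<open>Lifting projective tensor products\<close>

text \<open>
  The linear extension to formal combinations of pairs kills the bilinearity relations.
\<close>

theorem tensor_lift:
  fixes B :: "'a::real_vector \<Rightarrow> 'b::real_vector \<Rightarrow> 'c::real_vector"
  assumes B: "\<And>y. linear (\<lambda>x. B x y)" "\<And>x. linear (B x)"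
  obtains L :: "('a, 'b) tensor \<Rightarrow> 'c" where "linear L" "\<And>x y. L (pure_tensor x y) = B x y"
proof -
  define F :: "(('a \<times> 'b) \<Rightarrow>\<^sub>0 real) \<Rightarrow> 'c"
    where "F s = (\<Sum>k\<in>Poly_Mapping.keys s. Poly_Mapping.lookup s k *\<^sub>R B (fst k) (snd k))" for s
  have F_sum: "F s = (\<Sum>k\<in>A. Poly_Mapping.lookup s k *\<^sub>R B (fst k) (snd k))"
    if "finite A" "Poly_Mapping.keys s \<subseteq> A" for s A
    unfolding F_def by (rule sum.mono_neutral_left[OF that]) (auto simp: in_keys_iff)
  have "linear F"
  proof (rule linearI)
    fix s t :: "('a \<times> 'b) \<Rightarrow>\<^sub>0 real"
    let ?A = "Poly_Mapping.keys s \<union> Poly_Mapping.keys t"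
    show "F (s + t) = F s + F t"
      using Poly_Mapping.keys_add[of s t]
      by (simp add: F_sum[of ?A] lookup_add scaleR_add_left sum.distrib)
  next
    fix c and s :: "('a \<times> 'b) \<Rightarrow>\<^sub>0 real"
    have "Poly_Mapping.keys (c *\<^sub>R s) \<subseteq> Poly_Mapping.keys s"
      by (auto simp: in_keys_iff scaleR_poly_mapping.rep_eq)
    then show "F (c *\<^sub>R s) = c *\<^sub>R F s"
      by (simp add: F_sum[of "Poly_Mapping.keys s"] scaleR_poly_mapping.rep_eq scaleR_sum_right)
  qed
  have F_formal: "F (formal_tensor x y) = B x y" for x y
    by (simp add: F_def)
  have "bilinear_relations \<subseteq> {s. F s = 0}"
    unfolding bilinear_relations_def
  proof (rule span_minimal)
    show "subspace {s. F s = 0}"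
      by (auto simp: subspace_def linear_0 linear_add linear_scale \<open>linear F\<close>)
  qed (auto simp: linear_diff[OF \<open>linear F\<close>] linear_scale[OF \<open>linear F\<close>] F_formal
      linear_add[OF B(1)] linear_add[OF B(2)] linear_scale[OF B(1)] linear_scale[OF B(2)])
  then have F_eq: "F s = F t" if "tensor_class s = tensor_class t" for s t
    using that linear_diff[OF \<open>linear F\<close>, of s t] by (auto simp: tensor.abs_eq_iff)
  define L where "L u = F (Rep_tensor u)" for u
  have L_class: "L (tensor_class s) = F s" for s
    unfolding L_def by (rule F_eq) (rule Quotient3_abs_rep[OF Quotient3_tensor])
  have surj: "\<exists>s. u = tensor_class s" for u :: "('a, 'b) tensor"
    by (metis Quotient3_abs_rep[OF Quotient3_tensor])
  show ?thesis
  proof (rule that[of L])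
    show "linear L"
    proof (rule linearI)
      fix u v :: "('a, 'b) tensor" and c :: real
      obtain s t where "u = tensor_class s" "v = tensor_class t" using surj by metis
      then show "L (u + v) = L u + L v" "L (c *\<^sub>R u) = c *\<^sub>R L u"
        by (simp_all add: plus_tensor.abs_eq scaleR_tensor.abs_eq L_class
            linear_add linear_scale \<open>linear F\<close>)
    qed
    show "L (pure_tensor x y) = B x y" for x y
      by (simp add: pure_tensor.abs_eq L_class F_formal)
  qed
qed

lemma ptensor_class_add:
  assumes "projective_Cauchy s" "projective_Cauchy t"
  shows "ptensor_class s + ptensor_class t = ptensor_class (\<lambda>n. s n + t n)"
  by (rule plus_ptensor.abs_eq) (simp_all add: eq_onp_def assms projective_null_zero)

lemma ptensor_class_scaleR:
  assumes "projective_Cauchy s"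
  shows "c *\<^sub>R ptensor_class s = ptensor_class (\<lambda>n. c *\<^sub>R s n)"
  by (rule scaleR_ptensor.abs_eq) (simp add: eq_onp_def assms projective_null_zero)

lemma norm_ptensor_class:
  assumes "projective_Cauchy s"
  shows "(\<lambda>n. projective_norm (s n)) \<longlonglongrightarrow> norm (ptensor_class s)"
proof -
  have "norm (ptensor_class s) = lim (\<lambda>n. projective_norm (s n))"
    by (rule norm_ptensor.abs_eq) (simp add: eq_onp_def assms projective_null_zero)
  then show ?thesis using projective_Cauchy_convergent_norm[OF assms] by simp
qed

abbreviation ptensor_pure :: "'a::real_normed_vector \<Rightarrow> 'b::real_normed_vector \<Rightarrow> ('a, 'b) ptensor"
  where "ptensor_pure x y \<equiv> ptensor_of (pure_tensor x y)"

lemma linear_ptensor_of: "linear ptensor_of"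
  by (rule linearI)
     (simp_all add: ptensor_of_def ptensor_class_add ptensor_class_scaleR projective_Cauchy_const)

lemma ptensor_pure_simps:
  "ptensor_pure (x + x') y = ptensor_pure x y + ptensor_pure x' y"
  "ptensor_pure x (y + y') = ptensor_pure x y + ptensor_pure x y'"
  "ptensor_pure (c *\<^sub>R x) y = c *\<^sub>R ptensor_pure x y"
  "ptensor_pure x (c *\<^sub>R y) = c *\<^sub>R ptensor_pure x y"
  by (simp_all add: pure_tensor_add_left pure_tensor_add_right pure_tensor_scaleR_left
      pure_tensor_scaleR_right linear_add linear_scale linear_ptensor_of)

lemma norm_ptensor_pure_le: "norm (ptensor_pure x y) \<le> norm x * norm y"
  using projective_norm_le[of "[(x, y)]"] by (simp add: norm_ptensor_of)

lemma ptensor_density: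
  fixes S :: "('a::real_normed_vector, 'b::real_normed_vector) ptensor set"
  assumes S: "subspace S" "closed S" and pure: "\<And>x y. ptensor_pure x y \<in> S"
  shows "z \<in> S"
proof -
  have alg: "ptensor_of u \<in> S" for u
  proof -
    obtain ps where u: "u = (\<Sum>(x, y)\<leftarrow>ps. pure_tensor x y)" using tensor_eq_sum_list by blast
    show ?thesis
      unfolding u
    proof (induction ps)
      case Nil
      then show ?case using subspace_0[OF S(1)] by (simp add: linear_0[OF linear_ptensor_of])
    next
      case (Cons p ps)
      then show ?case
        by (cases p) (auto simp: linear_add[OF linear_ptensor_of] intro!: subspace_add[OF S(1)] pure)
    qed
  qed
  obtain s where s: "projective_Cauchy s" "z = ptensor_class s" using ptensor_class_surj by blast
  show ?thesis
    unfolding s(2) by (rule closed_sequentially[OF S(2) alg ptensor_of_tendsto[OF s(1)]])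
qed

text \<open>
  The linearisation of B is dominated by the projective norm, hence maps Cauchy sequences of
  tensors to convergent ones; the value at a class is the limit along a representative.
\<close>

theorem ptensor_extension:
  fixes B :: "'a::real_normed_vector \<Rightarrow> 'b::real_normed_vector \<Rightarrow> 'c::banach"
  assumes B: "\<And>y. linear (\<lambda>x. B x y)" "\<And>x. linear (B x)"
    and norm_B: "\<And>x y. norm (B x y) \<le> norm x * norm y"
  obtains L :: "('a, 'b) ptensor \<Rightarrow>\<^sub>L 'c" where "norm L \<le> 1" "\<And>x y. L (ptensor_pure x y) = B x y"
proof -
  obtain L0 where L0: "linear L0" "\<And>x y. L0 (pure_tensor x y) = B x y"
    using tensor_lift[of B] B by metis
  have L0_norm: "norm (L0 u) \<le> projective_norm u" for u
  proof (rule projective_norm_ge)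
    fix ps assume u: "u = (\<Sum>(x, y)\<leftarrow>ps. pure_tensor x y)"
    show "norm (L0 u) \<le> (\<Sum>(x, y)\<leftarrow>ps. norm x * norm y)"
      unfolding u
    proof (induction ps)
      case Nil
      then show ?case by (simp add: linear_0[OF L0(1)])
    next
      case (Cons p ps)
      then show ?case
        by (cases p) (auto simp: linear_add[OF L0(1)] L0(2) intro!: norm_triangle_mono norm_B)
    qed
  qed
  define R where "R z v \<longleftrightarrow> (\<exists>s. projective_Cauchy s \<and> z = ptensor_class s \<and> (\<lambda>n. L0 (s n)) \<longlonglongrightarrow> v)"
    for z v
  obtain L where L: "norm L \<le> 1" "\<And>z v. R z v \<Longrightarrow> blinfun_apply L z = v"
  proof (rule blinfun_of_linear_graph[of R 1])
    show "R (z + w) (u + v)" if R: "R z u" "R w v" for z w u v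
    proof -
      obtain s t where "projective_Cauchy s" "z = ptensor_class s" "(\<lambda>n. L0 (s n)) \<longlonglongrightarrow> u"
        "projective_Cauchy t" "w = ptensor_class t" "(\<lambda>n. L0 (t n)) \<longlonglongrightarrow> v"
        using R unfolding R_def by blast
      then show ?thesis
        unfolding R_def
        by (intro exI[of _ "\<lambda>n. s n + t n"])
           (simp add: projective_Cauchy_add ptensor_class_add linear_add[OF L0(1)] tendsto_add)
    qed
    show "R (c *\<^sub>R z) (c *\<^sub>R u)" if R: "R z u" for c z u
    proof -
      obtain s where "projective_Cauchy s" "z = ptensor_class s" "(\<lambda>n. L0 (s n)) \<longlonglongrightarrow> u"
        using R by (auto simp: R_def)
      then show ?thesis
        unfolding R_def
        by (intro exI[of _ "\<lambda>n. c *\<^sub>R s n"])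
           (simp add: projective_Cauchy_scaleR ptensor_class_scaleR linear_scale[OF L0(1)] tendsto_intros)
    qed
    show "\<exists>v. R z v" for z
    proof -
      obtain s where s: "projective_Cauchy s" "z = ptensor_class s" using ptensor_class_surj by blast
      have "Cauchy (\<lambda>n. L0 (s n))"
        using s(1) L0_norm unfolding projective_Cauchy_def Cauchy_def dist_norm
        by (metis le_less_trans linear_diff[OF L0(1)])
      then show ?thesis using s by (auto simp: Cauchy_convergent_iff convergent_def R_def)
    qed
    show "norm v \<le> 1 * norm z" if R: "R z v" for z v
    proof -
      obtain s where s: "projective_Cauchy s" "z = ptensor_class s" "(\<lambda>n. L0 (s n)) \<longlonglongrightarrow> v"
        using R by (auto simp: R_def)
      have "norm v \<le> norm z"
        unfolding s(2)
        by (rule LIMSEQ_le[OF tendsto_norm[OF s(3)] norm_ptensor_class[OF s(1)]]) (use L0_norm in blast)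
      then show ?thesis by simp
    qed
  qed auto
  have "R (ptensor_pure x y) (B x y)" for x y
    unfolding R_def ptensor_of_def
    by (intro exI[of _ "\<lambda>_. pure_tensor x y"]) (simp add: projective_Cauchy_const L0)
  then show ?thesis using that L by blast
qed

text \<open>
  Here \<beta> = \<beta>_1 \<otimes> \<beta>_2.  A functional \<phi> on the tensor product is a bilinear form in (u, v), and
  it is extended to the biduals one variable at a time, as in Arens' construction: S_2 is
  applied in v with u fixed, and then S_1 in u.
\<close>

theorem bidual_lifting_ptensor:
  fixes \<beta>\<^sub>1 :: "'u::real_normed_vector \<Rightarrow>\<^sub>L 'a::real_normed_vector"
    and \<beta>\<^sub>2 :: "'v::real_normed_vector \<Rightarrow>\<^sub>L 'b::real_normed_vector"
  assumes "bidual_lifting \<beta>\<^sub>1 S\<^sub>1" "bidual_lifting \<beta>\<^sub>2 S\<^sub>2"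
  obtains \<beta> :: "('u, 'v) ptensor \<Rightarrow>\<^sub>L ('a, 'b) ptensor" and S where "bidual_lifting \<beta> S"
proof -
  have \<beta>\<^sub>1: "norm \<beta>\<^sub>1 \<le> 1" and S\<^sub>1: "norm S\<^sub>1 \<le> 1" and lift\<^sub>1: "\<And>x \<psi>. S\<^sub>1 x (\<psi> o\<^sub>L \<beta>\<^sub>1) = \<psi> x"
    and \<beta>\<^sub>2: "norm \<beta>\<^sub>2 \<le> 1" and S\<^sub>2: "norm S\<^sub>2 \<le> 1" and lift\<^sub>2: "\<And>y \<psi>. S\<^sub>2 y (\<psi> o\<^sub>L \<beta>\<^sub>2) = \<psi> y"
    using assms by (auto simp: bidual_lifting_def)
  obtain \<beta> where \<beta>: "norm \<beta> \<le> 1"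
    "\<And>u v. blinfun_apply \<beta> (ptensor_pure u v) = ptensor_pure (\<beta>\<^sub>1 u) (\<beta>\<^sub>2 v)"
  proof (rule ptensor_extension[of "\<lambda>u v. ptensor_pure (\<beta>\<^sub>1 u) (\<beta>\<^sub>2 v)"])
    show "norm (ptensor_pure (\<beta>\<^sub>1 u) (\<beta>\<^sub>2 v)) \<le> norm u * norm v" for u v
      by (rule order_trans[OF norm_ptensor_pure_le])
         (intro mult_mono contraction_blinfun_apply \<beta>\<^sub>1 \<beta>\<^sub>2 norm_ge_zero)
  qed (auto intro!: linearI simp: blinfun.bilinear_simps ptensor_pure_simps)
  \<comment> \<open>the two stages of the Arens extension: slice \<phi> u is a functional of v, to which
    S_2 y applies; the outcome E y \<phi> is a functional of u, to which S_1 x applies\<close>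
  define slice :: "('u, 'v) ptensor dual \<Rightarrow> 'u \<Rightarrow> 'v dual"
    where "slice \<phi> u = Blinfun (\<lambda>v. \<phi> (ptensor_pure u v))" for \<phi> u
  have slice_le: "\<bar>\<phi> (ptensor_pure u v)\<bar> \<le> norm \<phi> * norm u * norm v"
    for \<phi> :: "('u, 'v) ptensor dual" and u v
    using order_trans[OF abs_dual_apply_le[of \<phi>] mult_left_mono[OF norm_ptensor_pure_le norm_ge_zero]]
    by (simp add: mult.assoc)
  have slice_bl: "bounded_linear (\<lambda>v. \<phi> (ptensor_pure u v))" for \<phi> :: "('u, 'v) ptensor dual" and u
    by (rule bounded_linear_intro[of _ "norm \<phi> * norm u"])
       (use slice_le[of \<phi> u] in \<open>auto simp: ptensor_pure_simps blinfun.bilinear_simps mult_ac\<close>)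
  have slice: "slice \<phi> u v = \<phi> (ptensor_pure u v)" for \<phi> u v
    by (simp add: slice_def bounded_linear_Blinfun_apply[OF slice_bl])
  have slice_norm: "norm (slice \<phi> u) \<le> norm \<phi> * norm u" for \<phi> u
    by (rule norm_blinfun_bound) (use slice_le[of \<phi> u] in \<open>auto simp: slice\<close>)
  have slice_linear: "slice (\<phi> + \<phi>') u = slice \<phi> u + slice \<phi>' u" "slice (c *\<^sub>R \<phi>) u = c *\<^sub>R slice \<phi> u"
    "slice \<phi> (u + u') = slice \<phi> u + slice \<phi> u'" "slice \<phi> (c *\<^sub>R u) = c *\<^sub>R slice \<phi> u"
    for \<phi> \<phi>' u u' c
    by (auto intro!: blinfun_eqI simp: slice blinfun.bilinear_simps ptensor_pure_simps)
  define E :: "'b \<Rightarrow> ('u, 'v) ptensor dual \<Rightarrow> 'u dual"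
    where "E y \<phi> = Blinfun (\<lambda>u. S\<^sub>2 y (slice \<phi> u))" for y \<phi>
  have E_le: "\<bar>S\<^sub>2 y (slice \<phi> u)\<bar> \<le> norm y * norm \<phi> * norm u" for y \<phi> u
    using order_trans[OF abs_dual_apply_le mult_mono[OF contraction_blinfun_apply[OF S\<^sub>2] slice_norm]]
    by (simp add: mult.assoc)
  have E_bl: "bounded_linear (\<lambda>u. S\<^sub>2 y (slice \<phi> u))" for y \<phi>
    by (rule bounded_linear_intro[of _ "norm y * norm \<phi>"])
       (use E_le[of y \<phi>] in \<open>auto simp: slice_linear blinfun.bilinear_simps mult_ac\<close>)
  have E: "E y \<phi> u = S\<^sub>2 y (slice \<phi> u)" for y \<phi> u
    by (simp add: E_def bounded_linear_Blinfun_apply[OF E_bl])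
  have E_norm: "norm (E y \<phi>) \<le> norm y * norm \<phi>" for y \<phi>
    by (rule norm_blinfun_bound) (use E_le[of y \<phi>] in \<open>auto simp: E\<close>)
  have E_linear: "E y (\<phi> + \<phi>') = E y \<phi> + E y \<phi>'" "E y (c *\<^sub>R \<phi>) = c *\<^sub>R E y \<phi>"
    "E (y + y') \<phi> = E y \<phi> + E y' \<phi>" "E (c *\<^sub>R y) \<phi> = c *\<^sub>R E y \<phi>" for \<phi> \<phi>' y y' c
    by (auto intro!: blinfun_eqI simp: E slice_linear blinfun.bilinear_simps)
  define B :: "'a \<Rightarrow> 'b \<Rightarrow> ('u, 'v) ptensor bidual"
    where "B x y = Blinfun (\<lambda>\<phi>. S\<^sub>1 x (E y \<phi>))" for x y
  have B_le: "\<bar>S\<^sub>1 x (E y \<phi>)\<bar> \<le> norm x * norm y * norm \<phi>" for x y \<phi>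
    using order_trans[OF abs_dual_apply_le mult_mono[OF contraction_blinfun_apply[OF S\<^sub>1] E_norm]]
    by (simp add: mult.assoc)
  have B_bl: "bounded_linear (\<lambda>\<phi>. S\<^sub>1 x (E y \<phi>))" for x y
    by (rule bounded_linear_intro[of _ "norm x * norm y"])
       (use B_le[of x y] in \<open>auto simp: E_linear blinfun.bilinear_simps mult_ac\<close>)
  have B: "B x y \<phi> = S\<^sub>1 x (E y \<phi>)" for x y \<phi>
    by (simp add: B_def bounded_linear_Blinfun_apply[OF B_bl])
  obtain S where S: "norm S \<le> 1" "\<And>x y. blinfun_apply S (ptensor_pure x y) = B x y"
  proof (rule ptensor_extension[of B])
    show "norm (B x y) \<le> norm x * norm y" for x y
      by (rule norm_blinfun_bound) (use B_le[of x y] in \<open>auto simp: B\<close>)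
  qed (auto intro!: linearI blinfun_eqI simp: B E_linear blinfun.bilinear_simps)
  have "S z (\<psi> o\<^sub>L \<beta>) = \<psi> z" for z \<psi>
  proof -
    have "z \<in> {z. S z (\<psi> o\<^sub>L \<beta>) = \<psi> z}"
    proof (rule ptensor_density)
      show "subspace {z. S z (\<psi> o\<^sub>L \<beta>) = \<psi> z}"
        by (auto simp: subspace_def blinfun.bilinear_simps)
      show "closed {z. S z (\<psi> o\<^sub>L \<beta>) = \<psi> z}"
        by (intro closed_Collect_eq continuous_intros)
      \<comment> \<open>if \<phi> = \<psi> \<circ> \<beta>, each of the two steps evaluates a functional of the form
        \<chi> \<circ> \<beta>_i, so both lifting identities apply\<close>
      fix x y
      have right: "bounded_linear (\<lambda>b. \<psi> (ptensor_pure a b))" for a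
        by (rule bounded_linear_intro[of _ "norm \<psi> * norm a"])
           (use order_trans[OF abs_dual_apply_le mult_left_mono[OF norm_ptensor_pure_le]] in
             \<open>auto simp: ptensor_pure_simps blinfun.bilinear_simps mult_ac\<close>)
      have left: "bounded_linear (\<lambda>a. \<psi> (ptensor_pure a y))"
        by (rule bounded_linear_intro[of _ "norm \<psi> * norm y"])
           (use order_trans[OF abs_dual_apply_le mult_left_mono[OF norm_ptensor_pure_le]] in
             \<open>auto simp: ptensor_pure_simps blinfun.bilinear_simps mult_ac\<close>)
      have "slice (\<psi> o\<^sub>L \<beta>) u = Blinfun (\<lambda>b. \<psi> (ptensor_pure (\<beta>\<^sub>1 u) b)) o\<^sub>L \<beta>\<^sub>2" for u
        by (rule blinfun_eqI) (simp add: slice \<beta>(2) bounded_linear_Blinfun_apply[OF right])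
      then have "E y (\<psi> o\<^sub>L \<beta>) = Blinfun (\<lambda>a. \<psi> (ptensor_pure a y)) o\<^sub>L \<beta>\<^sub>1"
        by (intro blinfun_eqI)
           (simp add: E lift\<^sub>2 bounded_linear_Blinfun_apply[OF left] bounded_linear_Blinfun_apply[OF right])
      then show "ptensor_pure x y \<in> {z. S z (\<psi> o\<^sub>L \<beta>) = \<psi> z}"
        by (simp add: S(2) B lift\<^sub>1 bounded_linear_Blinfun_apply[OF left])
    qed
    then show ?thesis by simp
  qed
  then have "bidual_lifting \<beta> S" using \<beta>(1) S(1) by (simp add: bidual_lifting_def)
  then show ?thesis by (rule that)
qed

theorem corollary4p19:
  shows "(\<exists>T :: 'x::banach ph_free \<Rightarrow> 'x lip_free bidual. linear_isometric_embedding T)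
    \<and> (\<exists>T :: 'x \<Rightarrow> 'x lip_free bidual. linear_isometric_embedding T)
    \<and> (\<exists>T :: ('x, 'y::banach) ptensor \<Rightarrow> ('x lip_free, 'y lip_free) ptensor bidual.
          linear_isometric_embedding T)"
proof -
  obtain \<pi> :: "'x lip_free \<Rightarrow>\<^sub>L 'x ph_free" and P where P: "bidual_lifting \<pi> P"
    by (rule bidual_lifting_ph_free)
  obtain \<beta>\<^sub>1 :: "'x lip_free \<Rightarrow>\<^sub>L 'x" and S\<^sub>1 where S\<^sub>1: "bidual_lifting \<beta>\<^sub>1 S\<^sub>1"
    by (rule bidual_lifting_barycentre)
  obtain \<beta>\<^sub>2 :: "'y lip_free \<Rightarrow>\<^sub>L 'y" and S\<^sub>2 where S\<^sub>2: "bidual_lifting \<beta>\<^sub>2 S\<^sub>2"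
    by (rule bidual_lifting_barycentre)
  obtain \<beta> :: "('x lip_free, 'y lip_free) ptensor \<Rightarrow>\<^sub>L ('x, 'y) ptensor" and S
    where S: "bidual_lifting \<beta> S"
    by (rule bidual_lifting_ptensor[OF S\<^sub>1 S\<^sub>2])
  show ?thesis
    using bidual_lifting_isometric[OF P] bidual_lifting_isometric[OF S\<^sub>1]
      bidual_lifting_isometric[OF S] by blast
qed

end
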